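(* Let $R$ be a commutative chain ring with maximal ideal $\mathfrak{m}$ and residue field $\mathbb{F}=R/\mathfrak{m}$, such that $\bigcap_{\ell\ge1}\mathfrak{m}^\ell=\{0\}$. Let $V$ be an $R$-module, $E$ a finite set, and $A\colon E\to V$ a map. For $S\subseteq E$ let $V_S$ be the $R$-submodule of $V$ generated by $\{A(i):i\in S\}$. Then the rank function $r_{M[A]}$ of the independence system $M[A]$ is submodular (i.e. $r(X\cup Y)+r(X\cap Y)\le r(X)+r(Y)$ for all $X,Y\subseteq E$) if and only if $$\dim_{\mathbb{F}}\frac{V_{X\cap Y}}{\mathfrak{m}V_{X\cap Y}}\le \dim_{\mathbb{F}}\frac{V_X\cap V_Y}{\mathfrak{m}V_X\cap\mathfrak{m}V_Y}\quad\text{for all }X,Y\subseteq E.$$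
   Context: A chain ring is a commutative ring whose ideals are totally ordered by inclusion; it is local. For a local commutative ring $(R,\mathfrak{m})$, elements $v_1,\dots,v_\ell$ of an $R$-module are modular independent if $\alpha_1v_1+\dots+\alpha_\ell v_\ell=0$ with $\alpha_i\in R$ implies $\alpha_i\in\mathfrak{m}$ for all $i$. For $A\colon E\to V$, $M[A]$ is the independence system on $E$ whose independent sets are the $I\subseteq E$ such that the family $(A(i))_{i\in I}$ is modular independent. The rank function of an independence system is $r(X)=\max\{|I|: I\subseteq X,\ I\text{ independent}\}$. *)

theory Defs
  imports "Jordan_Normal_Form.Missing_VectorSpace" "HOL-Algebra.Ideal_Product"
    "HOL-Algebra.QuotRing"
begin

text \<open>Nontriviality is not part of the locale; it follows as soon as a maximal ideal of \<open>R\<close> is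
  given, since maximal ideals are proper.\<close>

locale chain_ring = cring R for R (structure) +
  assumes ideals_chain: "\<lbrakk>ideal I R; ideal J R\<rbrakk> \<Longrightarrow> I \<subseteq> J \<or> J \<subseteq> I"

definition modular_independent ::
    "('a, 'b) ring_scheme \<Rightarrow> 'a set \<Rightarrow> ('a, 'v, 'w) module_scheme \<Rightarrow> ('e \<Rightarrow> 'v) \<Rightarrow> 'e set \<Rightarrow> bool"
  where "modular_independent R \<mm> V A I \<longleftrightarrow>
    (\<forall>\<alpha> \<in> I \<rightarrow> carrier R.
      (\<Oplus>\<^bsub>V\<^esub>i\<in>I. \<alpha> i \<odot>\<^bsub>V\<^esub> A i) = \<zero>\<^bsub>V\<^esub> \<longrightarrow> (\<forall>i\<in>I. \<alpha> i \<in> \<mm>))"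

text \<open>The independence system \<open>M[A]\<close>, given by its family of independent sets. Independence is that
  of the family \<open>(A i)\<close> indexed by \<open>I\<close>, not of the set \<open>A ` I\<close>: repeated vectors count.\<close>

definition modular_indep_system ::
    "('a, 'b) ring_scheme \<Rightarrow> 'a set \<Rightarrow> ('a, 'v, 'w) module_scheme \<Rightarrow> 'e set \<Rightarrow> ('e \<Rightarrow> 'v) \<Rightarrow> 'e set set"
  where "modular_indep_system R \<mm> V E A = {I. I \<subseteq> E \<and> modular_independent R \<mm> V A I}"

definition indep_rank :: "'e set set \<Rightarrow> 'e set \<Rightarrow> nat"
  where "indep_rank \<I> X = Max {card I | I. I \<subseteq> X \<and> I \<in> \<I>}"

definition submodular_on :: "'e set \<Rightarrow> ('e set \<Rightarrow> nat) \<Rightarrow> bool"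
  where "submodular_on E r \<longleftrightarrow>
    (\<forall>X Y. X \<subseteq> E \<longrightarrow> Y \<subseteq> E \<longrightarrow> r (X \<union> Y) + r (X \<inter> Y) \<le> r X + r Y)"

definition gen_submodule ::
    "('a, 'b) ring_scheme \<Rightarrow> ('a, 'v, 'w) module_scheme \<Rightarrow> ('e \<Rightarrow> 'v) \<Rightarrow> 'e set \<Rightarrow> 'v set"
  where "gen_submodule R V A S = LinearCombinations.module.span R V (A ` S)"

definition ideal_smult ::
    "('a, 'b) ring_scheme \<Rightarrow> ('a, 'v, 'w) module_scheme \<Rightarrow> 'a set \<Rightarrow> 'v set \<Rightarrow> 'v set"
  where "ideal_smult R V \<aa> N =
    LinearCombinations.module.span R V {a \<odot>\<^bsub>V\<^esub> v | a v. a \<in> \<aa> \<and> v \<in> N}"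

text \<open>The quotient \<open>N / P\<close> of submodules \<open>P \<subseteq> N\<close> of \<open>V\<close> as a module over \<open>R Quot \<mm>\<close>, assuming
  \<open>\<mm> N \<subseteq> P\<close>. As with multiplication in \<open>R Quot \<mm>\<close>, the scalar product of the cosets of \<open>r\<close> and \<open>x\<close> is
  written as a union over representatives, all members of which equal \<open>P + r x\<close>. The fields
  \<open>mult\<close> and \<open>one\<close> are irrelevant for modules.\<close>

definition quot_module ::
    "('a, 'v, 'w) module_scheme \<Rightarrow> 'v set \<Rightarrow> 'v set \<Rightarrow> ('a set, 'v set) module"
  where "quot_module V N P =
    \<lparr>carrier = {P +>\<^bsub>V\<^esub> x | x. x \<in> N}, mult = undefined, one = undefined,
     zero = P, add = (<+>\<^bsub>V\<^esub>),
     smult = (\<lambda>c X. \<Union>r\<in>c. \<Union>x\<in>X. P +>\<^bsub>V\<^esub> (r \<odot>\<^bsub>V\<^esub> x))\<rparr>"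

lemma quot_module_vectorspace:
  assumes "cring R" "maximalideal \<mm> R" "module R V"
    and N: "submodule R N V" and P: "submodule R P V" and "P \<subseteq> N"
    and mN: "\<And>a x. \<lbrakk>a \<in> \<mm>; x \<in> N\<rbrakk> \<Longrightarrow> a \<odot>\<^bsub>V\<^esub> x \<in> P"
  shows "vectorspace (R Quot \<mm>) (quot_module V N P)"
proof -
  interpret R: cring R by fact
  interpret V: module R V by fact
  interpret m: maximalideal \<mm> R by fact
  interpret F: field "R Quot \<mm>" by (rule m.quotient_is_field) fact
  interpret N: submodule R N V by fact
  interpret P: submodule R P V by fact
  let ?Q = "quot_module V N P"
  have neg: "\<ominus>\<^bsub>V\<^esub> x = (\<ominus>\<^bsub>R\<^esub> \<one>\<^bsub>R\<^esub>) \<odot>\<^bsub>V\<^esub> x" if "x \<in> carrier V" for x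
    using that by (simp add: V.smult_l_minus)
  have negP: "\<ominus>\<^bsub>V\<^esub> x \<in> P" if "x \<in> P" for x
    using that P.subset P.smult_closed[of "\<ominus>\<^bsub>R\<^esub> \<one>\<^bsub>R\<^esub>" x] by (auto simp: neg)
  have negN: "\<ominus>\<^bsub>V\<^esub> x \<in> N" if "x \<in> N" for x
    using that N.subset N.smult_closed[of "\<ominus>\<^bsub>R\<^esub> \<one>\<^bsub>R\<^esub>" x] by (auto simp: neg)
  have asg: "abelian_subgroup P V"
    by (rule abelian_subgroupI3)
       (auto intro!: additive_subgroup.intro V.add.subgroupI P.subset[THEN subsetD]
         simp: P.subset negP a_inv_def[symmetric] V.abelian_group_axioms
         intro: P.zero_closed P.smult_closed P.m_closed)
  interpret P': abelian_subgroup P V by (rule asg)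
  have Nc: "x \<in> carrier V" if "x \<in> N" for x using that N.subset by auto
  have eqI: "P +>\<^bsub>V\<^esub> x = P +>\<^bsub>V\<^esub> y" if "x \<in> P +>\<^bsub>V\<^esub> y" "y \<in> carrier V" for x y
    using that by (metis P'.a_repr_independence')
  have add: "(P +>\<^bsub>V\<^esub> x) <+>\<^bsub>V\<^esub> (P +>\<^bsub>V\<^esub> y) = P +>\<^bsub>V\<^esub> (x \<oplus>\<^bsub>V\<^esub> y)"
    if "x \<in> N" "y \<in> N" for x y
    using that Nc by (simp add: P'.a_rcos_sum)
  have carF: "carrier (R Quot \<mm>) = {\<mm> +>\<^bsub>R\<^esub> r | r. r \<in> carrier R}"
    by (auto simp: FactRing_def A_RCOSETS_def' )
  have mult: "(\<mm> +>\<^bsub>R\<^esub> r) \<otimes>\<^bsub>R Quot \<mm>\<^esub> (\<mm> +>\<^bsub>R\<^esub> s) = \<mm> +>\<^bsub>R\<^esub> (r \<otimes>\<^bsub>R\<^esub> s)"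
    if "r \<in> carrier R" "s \<in> carrier R" for r s
    using that by (simp add: FactRing_def m.rcoset_mult_add)
  have addF: "(\<mm> +>\<^bsub>R\<^esub> r) \<oplus>\<^bsub>R Quot \<mm>\<^esub> (\<mm> +>\<^bsub>R\<^esub> s) = \<mm> +>\<^bsub>R\<^esub> (r \<oplus>\<^bsub>R\<^esub> s)"
    if "r \<in> carrier R" "s \<in> carrier R" for r s
    using that by (simp add: FactRing_def m.a_rcos_sum)
  have smult: "(\<mm> +>\<^bsub>R\<^esub> r) \<odot>\<^bsub>?Q\<^esub> (P +>\<^bsub>V\<^esub> x) = P +>\<^bsub>V\<^esub> (r \<odot>\<^bsub>V\<^esub> x)"
    if r: "r \<in> carrier R" and x: "x \<in> N" for r x
  proof -
    have key: "P +>\<^bsub>V\<^esub> (r' \<odot>\<^bsub>V\<^esub> x') = P +>\<^bsub>V\<^esub> (r \<odot>\<^bsub>V\<^esub> x)"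
      if "r' \<in> \<mm> +>\<^bsub>R\<^esub> r" "x' \<in> P +>\<^bsub>V\<^esub> x" for r' x'
    proof -
      from that obtain a p where a: "a \<in> \<mm>" "r' = a \<oplus>\<^bsub>R\<^esub> r" and p: "p \<in> P" "x' = p \<oplus>\<^bsub>V\<^esub> x"
        by (auto simp: a_r_coset_def')
      have ac: "a \<in> carrier R" and pc: "p \<in> carrier V" and pN: "p \<in> N" and xc: "x \<in> carrier V"
        using a p x m.Icarr P.subset \<open>P \<subseteq> N\<close> Nc by auto
      have "r' \<odot>\<^bsub>V\<^esub> x' = (a \<odot>\<^bsub>V\<^esub> x' \<oplus>\<^bsub>V\<^esub> r \<odot>\<^bsub>V\<^esub> p) \<oplus>\<^bsub>V\<^esub> r \<odot>\<^bsub>V\<^esub> x"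
        using r ac pc xc by (simp add: a p V.smult_l_distr V.smult_r_distr V.a_ac)
      moreover have "a \<odot>\<^bsub>V\<^esub> x' \<oplus>\<^bsub>V\<^esub> r \<odot>\<^bsub>V\<^esub> p \<in> P"
        using a p r x pN by (intro P.m_closed mN P.smult_closed) auto
      ultimately have "r' \<odot>\<^bsub>V\<^esub> x' \<in> P +>\<^bsub>V\<^esub> (r \<odot>\<^bsub>V\<^esub> x)"
        by (auto simp: a_r_coset_def')
      then show ?thesis using r xc by (intro eqI) auto
    qed
    have self: "r \<in> \<mm> +>\<^bsub>R\<^esub> r" "x \<in> P +>\<^bsub>V\<^esub> x"
      using r x Nc m.a_rcos_self P'.a_rcos_self by auto
    have "(\<Union>r'\<in>\<mm> +>\<^bsub>R\<^esub> r. \<Union>x'\<in>P +>\<^bsub>V\<^esub> x. P +>\<^bsub>V\<^esub> (r' \<odot>\<^bsub>V\<^esub> x')) =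
        (\<Union>r'\<in>\<mm> +>\<^bsub>R\<^esub> r. \<Union>x'\<in>P +>\<^bsub>V\<^esub> x. P +>\<^bsub>V\<^esub> (r \<odot>\<^bsub>V\<^esub> x))"
      by (intro SUP_cong refl key)
    also have "\<dots> = P +>\<^bsub>V\<^esub> (r \<odot>\<^bsub>V\<^esub> x)" using self by blast
    finally show ?thesis by (simp add: quot_module_def)
  qed
  have car: "carrier ?Q = {P +>\<^bsub>V\<^esub> x | x. x \<in> N}" by (simp add: quot_module_def)
  have addQ: "(P +>\<^bsub>V\<^esub> x) \<oplus>\<^bsub>?Q\<^esub> (P +>\<^bsub>V\<^esub> y) = P +>\<^bsub>V\<^esub> (x \<oplus>\<^bsub>V\<^esub> y)"
    if "x \<in> N" "y \<in> N" for x y using add[OF that] by (simp add: quot_module_def)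
  have zero: "\<zero>\<^bsub>?Q\<^esub> = P +>\<^bsub>V\<^esub> \<zero>\<^bsub>V\<^esub>"
    using P.subset by (simp add: quot_module_def V.a_coset_add_zero)
  have carI: "P +>\<^bsub>V\<^esub> x \<in> carrier ?Q" if "x \<in> N" for x using that by (auto simp: car)
  have carE: "\<exists>x\<in>N. X = P +>\<^bsub>V\<^esub> x" if "X \<in> carrier ?Q" for X using that by (auto simp: car)
  have FE: "\<exists>r\<in>carrier R. c = \<mm> +>\<^bsub>R\<^esub> r" if "c \<in> carrier (R Quot \<mm>)" for c
    using that by (auto simp: carF)
  have one: "\<one>\<^bsub>R Quot \<mm>\<^esub> = \<mm> +>\<^bsub>R\<^esub> \<one>\<^bsub>R\<^esub>" by (simp add: FactRing_def)
  have "abelian_group ?Q"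
  proof (rule abelian_groupI)
    fix X Y assume "X \<in> carrier ?Q" "Y \<in> carrier ?Q"
    then obtain x y where xy: "x \<in> N" "X = P +>\<^bsub>V\<^esub> x" "y \<in> N" "Y = P +>\<^bsub>V\<^esub> y"
      using carE by meson
    then show "X \<oplus>\<^bsub>?Q\<^esub> Y \<in> carrier ?Q" by (simp add: addQ carI)
    show "X \<oplus>\<^bsub>?Q\<^esub> Y = Y \<oplus>\<^bsub>?Q\<^esub> X" using xy by (simp add: addQ V.a_comm Nc)
    fix Z assume "Z \<in> carrier ?Q"
    then obtain z where "z \<in> N" "Z = P +>\<^bsub>V\<^esub> z" using carE by meson
    then show "X \<oplus>\<^bsub>?Q\<^esub> Y \<oplus>\<^bsub>?Q\<^esub> Z = X \<oplus>\<^bsub>?Q\<^esub> (Y \<oplus>\<^bsub>?Q\<^esub> Z)"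
      using xy by (simp add: addQ V.a_assoc Nc)
  next
    show "\<zero>\<^bsub>?Q\<^esub> \<in> carrier ?Q" unfolding zero by (intro carI N.zero_closed)
  next
    fix X assume "X \<in> carrier ?Q"
    then obtain x where x: "x \<in> N" "X = P +>\<^bsub>V\<^esub> x" using carE by meson
    show "\<zero>\<^bsub>?Q\<^esub> \<oplus>\<^bsub>?Q\<^esub> X = X"
      unfolding zero x(2) by (subst addQ) (use x Nc in auto)
    have "(P +>\<^bsub>V\<^esub> (\<ominus>\<^bsub>V\<^esub> x)) \<oplus>\<^bsub>?Q\<^esub> X = \<zero>\<^bsub>?Q\<^esub>"
      unfolding zero x(2) by (subst addQ) (use x Nc in \<open>auto simp: negN V.l_neg\<close>)
    then show "\<exists>Y\<in>carrier ?Q. Y \<oplus>\<^bsub>?Q\<^esub> X = \<zero>\<^bsub>?Q\<^esub>"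
      using carI[OF negN[OF x(1)]] by meson
  qed
  then have "module (R Quot \<mm>) ?Q"
  proof (intro moduleI F.is_cring)
    fix c X assume "c \<in> carrier (R Quot \<mm>)" "X \<in> carrier ?Q"
    then obtain r x where rx: "r \<in> carrier R" "c = \<mm> +>\<^bsub>R\<^esub> r" "x \<in> N" "X = P +>\<^bsub>V\<^esub> x"
      using carE FE by meson
    then show "c \<odot>\<^bsub>?Q\<^esub> X \<in> carrier ?Q" by (simp add: smult carI)
    {
      fix d assume "d \<in> carrier (R Quot \<mm>)"
      then obtain s where "s \<in> carrier R" "d = \<mm> +>\<^bsub>R\<^esub> s" using FE by meson
      then show "(c \<oplus>\<^bsub>R Quot \<mm>\<^esub> d) \<odot>\<^bsub>?Q\<^esub> X = c \<odot>\<^bsub>?Q\<^esub> X \<oplus>\<^bsub>?Q\<^esub> d \<odot>\<^bsub>?Q\<^esub> X"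
        and "(c \<otimes>\<^bsub>R Quot \<mm>\<^esub> d) \<odot>\<^bsub>?Q\<^esub> X = c \<odot>\<^bsub>?Q\<^esub> (d \<odot>\<^bsub>?Q\<^esub> X)"
        using rx by (simp_all add: addF mult smult addQ Nc V.smult_l_distr V.smult_assoc1)
    }
    fix Y assume "Y \<in> carrier ?Q"
    then obtain y where "y \<in> N" "Y = P +>\<^bsub>V\<^esub> y" using carE by meson
    then show "c \<odot>\<^bsub>?Q\<^esub> (X \<oplus>\<^bsub>?Q\<^esub> Y) = c \<odot>\<^bsub>?Q\<^esub> X \<oplus>\<^bsub>?Q\<^esub> c \<odot>\<^bsub>?Q\<^esub> Y"
      using rx by (simp add: smult addQ Nc V.smult_r_distr)
  next
    fix X assume "X \<in> carrier ?Q"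
    then obtain x where "x \<in> N" "X = P +>\<^bsub>V\<^esub> x" using carE by meson
    then show "\<one>\<^bsub>R Quot \<mm>\<^esub> \<odot>\<^bsub>?Q\<^esub> X = X" by (simp add: one smult Nc)
  qed
  then show ?thesis
    by (intro vectorspace.intro F.field_axioms)
qed

end

theory Submission
  imports Defs
begin

text \<open>Both sides of the equivalence express the same inequality between dimensions over the
  residue field. Over a chain ring, elimination shows that a modular independent family in a
  submodule with \<open>n\<close> generators has at most \<open>n\<close> members, while a minimal subfamily of
  \<open>(A i)\<close>, \<open>i \<in> X\<close>, generating \<open>V\<^sub>X\<close> is modular independent and maps to a basis of \<open>V\<^sub>X / \<mm>V\<^sub>X\<close>.
  Hence \<open>r(X) = dim (V\<^sub>X / \<mm>V\<^sub>X)\<close>. As \<open>V\<^sub>X\<^sub>\<union>\<^sub>Y = V\<^sub>X + V\<^sub>Y\<close>, the kernel of the surjection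
  \<open>V\<^sub>X / \<mm>V\<^sub>X \<oplus> V\<^sub>Y / \<mm>V\<^sub>Y \<rightarrow> V\<^sub>X\<^sub>\<union>\<^sub>Y / \<mm>V\<^sub>X\<^sub>\<union>\<^sub>Y\<close> is \<open>(V\<^sub>X \<inter> V\<^sub>Y) / (\<mm>V\<^sub>X \<inter> \<mm>V\<^sub>Y)\<close>, so
  \<open>r(X \<union> Y) + dim ((V\<^sub>X \<inter> V\<^sub>Y) / (\<mm>V\<^sub>X \<inter> \<mm>V\<^sub>Y)) = r(X) + r(Y)\<close>.\<close>

section \<open>Finite dimension of subspaces and of extensions\<close>

lemma (in vectorspace) fin_dim_subspace:
  assumes fin_dim and W: "subspace K W V"
  shows "vectorspace.fin_dim K (vs W)"
proof -
  interpret W: vectorspace K "vs W" by (rule subspace_is_vs[OF W])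
  have sub: "submodule K W V" using W by (rule is_module)
  then have Wc: "W \<subseteq> carrier V" by (rule submodule.subset)
  \<comment> \<open>Independence inside \<open>W\<close> is independence inside \<open>V\<close>, so
    the dimension of \<open>V\<close> bounds all these sets. A maximal one therefore exists and is a
    finite basis of \<open>W\<close>.\<close>
  have "finite S \<and> card S \<le> dim" if "S \<subseteq> carrier (vs W) \<and> W.lin_indpt S" for S
    using that Wc li_le_dim[OF assms(1), of S] span_li_not_depend(2)[OF _ sub, of S] by auto
  moreover have "{} \<subseteq> carrier (vs W) \<and> W.lin_indpt {}"
    by (auto simp: W.lin_dep_def)
  ultimately obtain B where B: "finite B" "maximal B (\<lambda>S. S \<subseteq> carrier (vs W) \<and> W.lin_indpt S)"
    by (metis (no_types, lifting) maximal_exists)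
  have "W.basis B" using B(2) by (rule W.max_li_is_basis)
  with B(1) show ?thesis by (auto simp: W.fin_dim_def W.basis_def)
qed

text \<open>Lift a finite spanning set \<open>H\<close> of the image to \<open>S\<close> and add a
  finite spanning set \<open>G\<close> of the kernel: every vector differs from some combination of
  \<open>S\<close> by an element of the kernel.\<close>

lemma (in linear_map) fin_dim_if_fin_dim_ker_im:
  assumes ker: "vectorspace.fin_dim K (V.vs kerT)" and im: "vectorspace.fin_dim K (W.vs imT)"
  shows "V.fin_dim"
proof -
  interpret kerT: vectorspace K "V.vs kerT" by (rule V.subspace_is_vs[OF kerT_is_subspace])
  interpret imT: vectorspace K "W.vs imT" by (rule W.subspace_is_vs[OF imT_is_subspace])
  obtain G where G: "finite G" "G \<subseteq> kerT" "kerT.span G = kerT"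
    using ker by (auto simp: kerT.fin_dim_def)
  obtain H where H: "finite H" "H \<subseteq> imT" "imT.span H = imT"
    using im by (auto simp: imT.fin_dim_def)
  have spanG: "V.module.span G = kerT"
    using G V.module.span_li_not_depend(1)[OF G(2) ker_is_submodule] by simp
  have spanH: "W.module.span H = imT"
    using H W.module.span_li_not_depend(1)[OF H(2) im_is_submodule] by simp
  obtain S where S: "finite S" "S \<subseteq> carrier V" "T ` S = H"
    using H(1,2) finite_subset_image[of H T "carrier V"] by (auto simp: im_def)
  have GS: "G \<union> S \<subseteq> carrier V" using G(2) S(2) by (auto simp: ker_def)
  interpret SS: submodule K "V.module.span S" V by (rule V.module.span_is_submodule[OF S(2)])
  interpret GS: submodule K "V.module.span (G \<union> S)" V by (rule V.module.span_is_submodule[OF GS])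
  \<comment> \<open>Being a submodule that contains \<open>H\<close>, the image of the span of
    \<open>S\<close> contains the span of \<open>H\<close>, which is all of
    \<open>imT\<close>.\<close>
  have "submodule K (T ` V.module.span S) W"
  proof
    show "T ` V.module.span S \<subseteq> carrier W" using SS.subset by auto
    show "\<zero>\<^bsub>W\<^esub> \<in> T ` V.module.span S" using SS.zero_closed T0_is_0 by (metis image_eqI)
  next
    fix v w assume "v \<in> T ` V.module.span S" "w \<in> T ` V.module.span S"
    then obtain x y where "x \<in> V.module.span S" "y \<in> V.module.span S" "v = T x" "w = T y" by auto
    then show "v \<oplus>\<^bsub>W\<^esub> w \<in> T ` V.module.span S"
      using SS.subset by (intro image_eqI[of _ _ "x \<oplus>\<^bsub>V\<^esub> y"]) (auto simp: subsetD)
  next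
    fix c v assume "c \<in> carrier K" "v \<in> T ` V.module.span S"
    then show "c \<odot>\<^bsub>W\<^esub> v \<in> T ` V.module.span S"
      using SS.subset by (auto simp: subsetD intro!: image_eqI[where x = "c \<odot>\<^bsub>V\<^esub> _"])
  qed
  moreover have "H \<subseteq> T ` V.module.span S" using S V.module.in_own_span[OF S(2)] by auto
  ultimately have imS: "imT \<subseteq> T ` V.module.span S" using W.module.span_is_subset spanH by metis
  have "carrier V \<subseteq> V.module.span (G \<union> S)"
  proof
    fix v assume v: "v \<in> carrier V"
    then have "T v \<in> imT" by (auto simp: im_def)
    then obtain u where u: "u \<in> V.module.span S" "T v = T u" using imS by auto
    then have uc: "u \<in> carrier V" using SS.subset by auto
    have "v \<ominus>\<^bsub>V\<^esub> u \<in> kerT" using v uc u(2) by (auto simp: ker_def)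
    then have "v \<ominus>\<^bsub>V\<^esub> u \<in> V.module.span (G \<union> S)"
      using spanG V.module.span_is_monotone[of G "G \<union> S"] by auto
    moreover have "u \<in> V.module.span (G \<union> S)" using u V.module.span_is_monotone[of S "G \<union> S"] by auto
    ultimately have "(v \<ominus>\<^bsub>V\<^esub> u) \<oplus>\<^bsub>V\<^esub> u \<in> V.module.span (G \<union> S)" by blast
    moreover have "(v \<ominus>\<^bsub>V\<^esub> u) \<oplus>\<^bsub>V\<^esub> u = v"
      using v uc by (simp add: a_minus_def V.module.M.a_assoc V.module.M.l_neg)
    ultimately show "v \<in> V.module.span (G \<union> S)" by simp
  qed
  then show ?thesis
    using G(1) S(1) GS GS.subset by (auto simp: V.fin_dim_def)
qed

section \<open>Submodules, sums and cosets\<close>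

lemma (in module) submodule_minus_closed:
  assumes "submodule R N M" "x \<in> N"
  shows "\<ominus>\<^bsub>M\<^esub> x \<in> N"
proof -
  interpret N: submodule R N M by fact
  have "(\<ominus> \<one>) \<odot>\<^bsub>M\<^esub> x \<in> N" using assms(2) by (intro N.smult_closed) auto
  moreover have "(\<ominus> \<one>) \<odot>\<^bsub>M\<^esub> x = \<ominus>\<^bsub>M\<^esub> x"
    using assms(2) N.subset by (intro smult_minus_1) auto
  ultimately show ?thesis by simp
qed

lemma (in module) submodule_a_minus_closed:
  assumes "submodule R N M" "x \<in> N" "y \<in> N"
  shows "x \<ominus>\<^bsub>M\<^esub> y \<in> N"
  using submodule_minus_closed[OF assms(1,3)] assms
  by (auto simp: a_minus_def intro: submodule.m_closed)

lemma (in module) submodule_inter: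
  assumes "submodule R N M" "submodule R P M"
  shows "submodule R (N \<inter> P) M"
  using assms by (auto simp: submodule_def)

lemma (in module) submodule_finsum_closed:
  assumes N: "submodule R N M" and "f \<in> I \<rightarrow> N"
  shows "(\<Oplus>\<^bsub>M\<^esub>i\<in>I. f i) \<in> N"
proof -
  interpret N: submodule R N M by fact
  show ?thesis
    using assms(2)
  proof (induction I rule: infinite_finite_induct)
    case (insert i I)
    moreover from insert have "f \<in> I \<rightarrow> carrier M" "f i \<in> carrier M" using N.subset by auto
    ultimately show ?case by (subst M.finsum_insert) auto
  qed auto
qed

lemma (in module) mem_submodule_sum:
  "x \<in> submodule_sum N P \<longleftrightarrow> (\<exists>n\<in>N. \<exists>p\<in>P. x = n \<oplus>\<^bsub>M\<^esub> p)"
  by (auto simp: submodule_sum_def)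

lemma (in module) in_sum2:
  assumes "submodule R N M" "submodule R P M"
  shows "P \<subseteq> submodule_sum N P"
  using in_sum[OF assms(2,1)] msum_comm[OF assms] by simp

text \<open>Dedekind's modular law: if \<open>u + p\<close> lies in \<open>W\<close>, so does
  \<open>u\<close>, because \<open>p\<close> already does. It later identifies the kernels
  \<open>W \<inter> (U + W')\<close> and \<open>U \<inter> (U' + W')\<close>.\<close>

lemma (in module) submodule_modular_law:
  assumes U: "submodule R U M" and W: "submodule R W M" and P: "submodule R P M" and "P \<subseteq> W"
  shows "W \<inter> submodule_sum U P = submodule_sum (U \<inter> W) P"
proof
  show "submodule_sum (U \<inter> W) P \<subseteq> W \<inter> submodule_sum U P"
  proof
    fix x assume "x \<in> submodule_sum (U \<inter> W) P"
    then obtain u p where x: "u \<in> U" "u \<in> W" "p \<in> P" "x = u \<oplus>\<^bsub>M\<^esub> p"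
      by (auto simp: mem_submodule_sum)
    then show "x \<in> W \<inter> submodule_sum U P"
      using submodule.m_closed[OF W, of u p] \<open>P \<subseteq> W\<close> by (auto simp: mem_submodule_sum)
  qed
  show "W \<inter> submodule_sum U P \<subseteq> submodule_sum (U \<inter> W) P"
  proof
    fix x assume "x \<in> W \<inter> submodule_sum U P"
    then obtain u p where x: "u \<in> U" "p \<in> P" "x = u \<oplus>\<^bsub>M\<^esub> p" "x \<in> W"
      by (auto simp: mem_submodule_sum)
    then have "u \<in> carrier M" "p \<in> carrier M" using U P by (auto simp: submodule_def)
    then have "u = x \<ominus>\<^bsub>M\<^esub> p" using x(3) by (simp add: a_minus_def M.a_assoc M.r_neg)
    then have "u \<in> W" using x \<open>P \<subseteq> W\<close> submodule_a_minus_closed[OF W, of x p] by auto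
    then show "x \<in> submodule_sum (U \<inter> W) P" using x by (auto simp: mem_submodule_sum)
  qed
qed

lemma (in module) submodule_abelian_subgroup:
  assumes "submodule R P M"
  shows "abelian_subgroup P M"
proof -
  interpret P: submodule R P M by fact
  show ?thesis
    by (rule abelian_subgroupI3)
       (use P.subset submodule_minus_closed[OF assms] in
        \<open>auto intro!: additive_subgroup.intro M.add.subgroupI
          simp: M.abelian_group_axioms a_inv_def[symmetric] intro: P.zero_closed\<close>)
qed

lemma (in module) coset_eq_iff:
  assumes P: "submodule R P M" and x: "x \<in> carrier M" and y: "y \<in> carrier M"
  shows "P +>\<^bsub>M\<^esub> x = P +>\<^bsub>M\<^esub> y \<longleftrightarrow> x \<ominus>\<^bsub>M\<^esub> y \<in> P"
proof -
  interpret P: abelian_subgroup P M using P by (rule submodule_abelian_subgroup)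
  have "P +>\<^bsub>M\<^esub> x = P +>\<^bsub>M\<^esub> y \<longleftrightarrow> x \<in> P +>\<^bsub>M\<^esub> y"
    using P.a_repr_independence' P.a_rcos_self x y by metis
  also have "\<dots> \<longleftrightarrow> x \<ominus>\<^bsub>M\<^esub> y \<in> P"
    using P.a_rcos_module[OF y x] by (simp add: a_minus_def)
  finally show ?thesis .
qed

text \<open>Since \<open>K\<close> absorbs \<open>P\<close>, adding \<open>K\<close> to a coset of
  \<open>P\<close> describes the canonical map to cosets of \<open>K\<close> without choosing
  representatives.\<close>

lemma (in module) set_add_coset:
  assumes K: "submodule R K M" and P: "submodule R P M" and "P \<subseteq> K" and x: "x \<in> carrier M"
  shows "K <+>\<^bsub>M\<^esub> (P +>\<^bsub>M\<^esub> x) = K +>\<^bsub>M\<^esub> x"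
proof -
  interpret K: submodule R K M by fact
  interpret P: submodule R P M by fact
  have "k \<oplus>\<^bsub>M\<^esub> (p \<oplus>\<^bsub>M\<^esub> x) = (k \<oplus>\<^bsub>M\<^esub> p) \<oplus>\<^bsub>M\<^esub> x" if "k \<in> K" "p \<in> P" for k p
    using that x K.subset P.subset by (simp add: M.a_assoc subsetD)
  then have "K <+>\<^bsub>M\<^esub> (P +>\<^bsub>M\<^esub> x) = (\<lambda>v. v \<oplus>\<^bsub>M\<^esub> x) ` submodule_sum K P"
    by (force simp: set_add_defs a_r_coset_def' submodule_sum_def)
  moreover have "submodule_sum K P = K"
    using in_sum[OF K P] sum_is_minimal[OF K P K] \<open>P \<subseteq> K\<close> by blast
  ultimately show ?thesis by (auto simp: a_r_coset_def')
qed

section \<open>Subquotients over the residue field and the canonical maps between them\<close>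

locale residue_module = module R M + max: maximalideal \<mm> R
  for R (structure) and M (structure) and \<mm>
begin

abbreviation residue_field where "residue_field \<equiv> R Quot \<mm>"

text \<open>The last conjunct is what lets the action of \<open>R\<close> on the quotient factor
  through the residue field.\<close>

definition subquotient where
  "subquotient N P \<longleftrightarrow> submodule R N M \<and> submodule R P M \<and> P \<subseteq> N \<and>
    (\<forall>a\<in>\<mm>. \<forall>x\<in>N. a \<odot>\<^bsub>M\<^esub> x \<in> P)"

lemma subquotient_vectorspace:
  "subquotient N P \<Longrightarrow> vectorspace residue_field (quot_module M N P)"
  unfolding subquotient_def
  by (intro quot_module_vectorspace R.is_cring max.maximalideal_axioms module_axioms) auto

lemma subquotient_carrier: "subquotient N P \<Longrightarrow> N \<subseteq> carrier M"
  by (simp add: subquotient_def submodule_def)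

lemma quot_carrier: "carrier (quot_module M N P) = {P +>\<^bsub>M\<^esub> x | x. x \<in> N}"
  by (simp add: quot_module_def)

text \<open>\<open>N\<close> enters only the carrier field. Hence a kernel or an image, which linear
  algebra presents as the big quotient with its carrier replaced, is literally another
  \<open>quot_module\<close>.\<close>

lemma quot_update_carrier:
  "(quot_module M N P)\<lparr>carrier := carrier (quot_module M L P)\<rparr> = quot_module M L P"
  by (simp add: quot_module_def)

lemma residue_field_carrier: "carrier residue_field = {\<mm> +> r | r. r \<in> carrier R}"
  by (auto simp: FactRing_def A_RCOSETS_def')

lemma quot_zero: "\<zero>\<^bsub>quot_module M N P\<^esub> = P"
  by (simp add: quot_module_def)

lemma quot_add:
  assumes "subquotient N P" "x \<in> N" "y \<in> N"
  shows "(P +>\<^bsub>M\<^esub> x) \<oplus>\<^bsub>quot_module M N P\<^esub> (P +>\<^bsub>M\<^esub> y) = P +>\<^bsub>M\<^esub> (x \<oplus>\<^bsub>M\<^esub> y)"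
proof -
  interpret P: abelian_subgroup P M
    using assms(1) by (auto simp: subquotient_def intro: submodule_abelian_subgroup)
  show ?thesis
    using assms subquotient_carrier[OF assms(1)]
    by (auto simp: quot_module_def subsetD intro!: P.a_rcos_sum)
qed

text \<open>For \<open>s = a + r\<close> and \<open>y = p + x\<close> the products
  \<open>s y\<close> and \<open>r x\<close> differ by \<open>a y + r p\<close>, where
  \<open>a y\<close> is in \<open>P\<close> as \<mm> maps \<open>N\<close> into \<open>P\<close>,
  and \<open>r p\<close> as \<open>P\<close> is a submodule. So all members of the union defining
  the scalar product coincide.\<close>

lemma quot_smult:
  assumes NP: "subquotient N P" and r: "r \<in> carrier R" and x: "x \<in> N"
  shows "(\<mm> +> r) \<odot>\<^bsub>quot_module M N P\<^esub> (P +>\<^bsub>M\<^esub> x) = P +>\<^bsub>M\<^esub> (r \<odot>\<^bsub>M\<^esub> x)"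
proof -
  have sN: "submodule R N M" and sP: "submodule R P M" and "P \<subseteq> N"
    and mN: "\<And>a x. a \<in> \<mm> \<Longrightarrow> x \<in> N \<Longrightarrow> a \<odot>\<^bsub>M\<^esub> x \<in> P"
    using NP by (auto simp: subquotient_def)
  interpret N: submodule R N M by fact
  interpret P: submodule R P M by fact
  interpret P': abelian_subgroup P M using sP by (rule submodule_abelian_subgroup)
  have key: "P +>\<^bsub>M\<^esub> (s \<odot>\<^bsub>M\<^esub> y) = P +>\<^bsub>M\<^esub> (r \<odot>\<^bsub>M\<^esub> x)"
    if sy: "s \<in> \<mm> +> r" "y \<in> P +>\<^bsub>M\<^esub> x" for s y
  proof -
    obtain a p where a: "a \<in> \<mm>" "s = a \<oplus> r" and p: "p \<in> P" "y = p \<oplus>\<^bsub>M\<^esub> x"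
      using sy by (auto simp: a_r_coset_def')
    have yN: "y \<in> N" using p x \<open>P \<subseteq> N\<close> by auto
    have c: "a \<in> carrier R" "p \<in> carrier M" "x \<in> carrier M" "y \<in> carrier M"
      using a p x yN max.Icarr P.subset N.subset by auto
    have "s \<odot>\<^bsub>M\<^esub> y \<ominus>\<^bsub>M\<^esub> r \<odot>\<^bsub>M\<^esub> x = a \<odot>\<^bsub>M\<^esub> y \<oplus>\<^bsub>M\<^esub> r \<odot>\<^bsub>M\<^esub> p"
      using c r by (simp add: a(2) p(2) smult_l_distr smult_r_distr a_minus_def M.a_ac M.r_neg)
    moreover have "a \<odot>\<^bsub>M\<^esub> y \<oplus>\<^bsub>M\<^esub> r \<odot>\<^bsub>M\<^esub> p \<in> P"
      using a p r yN by (intro P.m_closed mN P.smult_closed) auto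
    ultimately show ?thesis
      using c r a by (subst coset_eq_iff[OF sP]) auto
  qed
  \<comment> \<open>Both index sets are inhabited, so the union of a constant family is that
    constant and not the empty set.\<close>
  have "r \<in> \<mm> +> r" "x \<in> P +>\<^bsub>M\<^esub> x"
    using r x N.subset max.a_rcos_self P'.a_rcos_self by auto
  moreover have "(\<Union>s\<in>\<mm> +> r. \<Union>y\<in>P +>\<^bsub>M\<^esub> x. P +>\<^bsub>M\<^esub> (s \<odot>\<^bsub>M\<^esub> y)) =
      (\<Union>s\<in>\<mm> +> r. \<Union>y\<in>P +>\<^bsub>M\<^esub> x. P +>\<^bsub>M\<^esub> (r \<odot>\<^bsub>M\<^esub> x))"
    by (intro SUP_cong refl key)
  ultimately have "(\<Union>s\<in>\<mm> +> r. \<Union>y\<in>P +>\<^bsub>M\<^esub> x. P +>\<^bsub>M\<^esub> (s \<odot>\<^bsub>M\<^esub> y)) = P +>\<^bsub>M\<^esub> (r \<odot>\<^bsub>M\<^esub> x)"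
    by blast
  then show ?thesis by (simp add: quot_module_def)
qed

context
  fixes N P K
  assumes NP: "subquotient N P" and K: "submodule R K M" and PK: "P \<subseteq> K"
begin

text \<open>In \<open>a (n + k)\<close> with \<open>a\<close> in \<mm>, the term \<open>a n\<close>
  lies in \<open>P\<close>, hence in \<open>K\<close>, and \<open>a k\<close> lies in
  \<open>K\<close> anyway.\<close>

lemma subquotient_sum: "subquotient (submodule_sum N K) K"
proof -
  have N: "submodule R N M" using NP by (simp add: subquotient_def)
  have "a \<odot>\<^bsub>M\<^esub> x \<in> K" if a: "a \<in> \<mm>" and "x \<in> submodule_sum N K" for a x
  proof -
    from that obtain n k where x: "n \<in> N" "k \<in> K" "x = n \<oplus>\<^bsub>M\<^esub> k"
      by (auto simp: mem_submodule_sum)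
    have "n \<in> carrier M" "k \<in> carrier M" "a \<in> carrier R"
      using x N K a max.Icarr by (auto simp: submodule_def)
    moreover have "a \<odot>\<^bsub>M\<^esub> n \<in> K" using NP PK a x by (auto simp: subquotient_def)
    ultimately show ?thesis
      using x submodule.smult_closed[OF K] submodule.m_closed[OF K] by (simp add: smult_r_distr)
  qed
  then show ?thesis
    using N K sum_is_submodule in_sum2 by (auto simp: subquotient_def)
qed

text \<open>Inclusion of \<open>N\<close> into \<open>N + K\<close> followed by reduction modulo
  \<open>K\<close>. It is onto because the \<open>K\<close>-part of \<open>n + k\<close> vanishes,
  and it kills exactly the classes of elements of \<open>K\<close>. For
  \<open>P = N \<inter> K\<close> this is the second isomorphism theorem.\<close>

lemma
  shows quot_linear_map: "linear_map residue_field (quot_module M N P)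
      (quot_module M (submodule_sum N K) K) (\<lambda>X. K <+>\<^bsub>M\<^esub> X)" (is ?lin)
    and quot_im: "mod_hom.im (quot_module M N P) (\<lambda>X. K <+>\<^bsub>M\<^esub> X) =
      carrier (quot_module M (submodule_sum N K) K)" (is ?im)
    and quot_ker: "mod_hom.ker (quot_module M N P) (quot_module M (submodule_sum N K) K)
      (\<lambda>X. K <+>\<^bsub>M\<^esub> X) = carrier (quot_module M (N \<inter> K) P)" (is ?ker)
proof -
  let ?NK = "submodule_sum N K"
  let ?Q = "quot_module M N P" and ?Q' = "quot_module M ?NK K"
  let ?T = "\<lambda>X. K <+>\<^bsub>M\<^esub> X"
  interpret Q: vectorspace residue_field ?Q by (rule subquotient_vectorspace[OF NP])
  interpret Q': vectorspace residue_field ?Q' by (rule subquotient_vectorspace[OF subquotient_sum])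
  have N: "submodule R N M" and P: "submodule R P M" using NP by (auto simp: subquotient_def)
  interpret K': abelian_subgroup K M using K by (rule submodule_abelian_subgroup)
  have Nc: "x \<in> carrier M" if "x \<in> N" for x using that N by (auto simp: submodule_def)
  have NK: "x \<in> ?NK" if "x \<in> N" for x using that in_sum[OF N K] by auto
  have T: "?T (P +>\<^bsub>M\<^esub> x) = K +>\<^bsub>M\<^esub> x" if "x \<in> N" for x
    using that by (intro set_add_coset K P PK Nc)
  have "?T \<in> module_hom residue_field ?Q ?Q'"
    unfolding module_hom_def
  proof (intro CollectI conjI allI impI)
    show "?T \<in> carrier ?Q \<rightarrow> carrier ?Q'"
      using T NK by (auto simp: quot_carrier)
  next
    fix X Y assume "X \<in> carrier ?Q \<and> Y \<in> carrier ?Q"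
    then obtain x y where "x \<in> N" "y \<in> N" "X = P +>\<^bsub>M\<^esub> x" "Y = P +>\<^bsub>M\<^esub> y"
      by (auto simp: quot_carrier)
    moreover have "x \<oplus>\<^bsub>M\<^esub> y \<in> N" using calculation submodule.m_closed[OF N] by auto
    ultimately show "?T (X \<oplus>\<^bsub>?Q\<^esub> Y) = ?T X \<oplus>\<^bsub>?Q'\<^esub> ?T Y"
      using NK by (simp add: quot_add[OF NP] quot_add[OF subquotient_sum] T)
  next
    fix c X assume "c \<in> carrier residue_field \<and> X \<in> carrier ?Q"
    then obtain r x where "r \<in> carrier R" "x \<in> N" "c = \<mm> +> r" "X = P +>\<^bsub>M\<^esub> x"
      by (auto simp: quot_carrier residue_field_carrier)
    moreover have "r \<odot>\<^bsub>M\<^esub> x \<in> N" using calculation submodule.smult_closed[OF N] by auto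
    ultimately show "?T (c \<odot>\<^bsub>?Q\<^esub> X) = c \<odot>\<^bsub>?Q'\<^esub> ?T X"
      using NK by (simp add: quot_smult[OF NP] quot_smult[OF subquotient_sum] T)
  qed
  then show ?lin
    by (intro linear_map.intro mod_hom.intro mod_hom_axioms.intro
        Q.vectorspace_axioms Q'.vectorspace_axioms Q.module_axioms Q'.module_axioms)
  then interpret T: linear_map residue_field ?Q ?Q' ?T .
  \<comment> \<open>The \<open>N\<close>-component of \<open>x\<close> represents the same coset,
    since the difference is the \<open>K\<close>-component.\<close>
  have "K +>\<^bsub>M\<^esub> x \<in> (\<lambda>x. K +>\<^bsub>M\<^esub> x) ` N" if "x \<in> ?NK" for x
  proof -
    from that obtain n k where x: "n \<in> N" "k \<in> K" "x = n \<oplus>\<^bsub>M\<^esub> k"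
      by (auto simp: mem_submodule_sum)
    have c: "n \<in> carrier M" "k \<in> carrier M" using x N K by (auto simp: submodule_def)
    then have "x \<ominus>\<^bsub>M\<^esub> n = k"
      using x(3) by (simp add: a_minus_def M.a_comm[of n k] M.a_assoc M.r_neg)
    then show ?thesis
      using x c by (intro image_eqI[of _ _ n]) (auto simp: coset_eq_iff[OF K])
  qed
  then have "carrier ?Q' = (\<lambda>x. K +>\<^bsub>M\<^esub> x) ` N"
    using NK unfolding quot_carrier by (intro equalityI subsetI) (blast, blast)
  moreover have "?T ` carrier ?Q = (\<lambda>x. K +>\<^bsub>M\<^esub> x) ` N"
    unfolding quot_carrier Setcompr_eq_image image_image by (rule image_cong[OF refl T])
  ultimately show ?im
    unfolding T.im_def by simp
  have T0: "?T (P +>\<^bsub>M\<^esub> x) = K \<longleftrightarrow> x \<in> K" if "x \<in> N" for x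
    using K'.a_rcos_const[of x] K'.a_rcos_self[OF Nc[OF that]] T[OF that] by metis
  show ?ker
    unfolding T.ker_def quot_carrier quot_zero
  proof (intro equalityI subsetI; elim CollectE exE conjE IntE)
    fix X x assume "?T X = K" "X = P +>\<^bsub>M\<^esub> x" "x \<in> N"
    then show "X \<in> {P +>\<^bsub>M\<^esub> x |x. x \<in> N \<inter> K}" using T0[of x] by blast
  next
    fix X x assume "X = P +>\<^bsub>M\<^esub> x" "x \<in> N" "x \<in> K"
    then show "X \<in> {v \<in> {P +>\<^bsub>M\<^esub> x |x. x \<in> N}. ?T v = K}" using T0[of x] by blast
  qed
qed

text \<open>Images and subspaces inherit finite dimension, and kernel and image give it back. Both
  directions are needed: additivity of \<open>dim\<close> presupposes finite dimension, which has to
  travel down to factors and up to other quotients.\<close>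

lemma quot_fin_dim_iff:
  "vectorspace.fin_dim residue_field (quot_module M N P) \<longleftrightarrow>
    vectorspace.fin_dim residue_field (quot_module M (submodule_sum N K) K) \<and>
    vectorspace.fin_dim residue_field (quot_module M (N \<inter> K) P)" (is "?l \<longleftrightarrow> ?r")
proof -
  interpret T: linear_map residue_field "quot_module M N P"
    "quot_module M (submodule_sum N K) K" "\<lambda>X. K <+>\<^bsub>M\<^esub> X" by (rule quot_linear_map)
  show ?thesis
  proof
    assume l: ?l
    show ?r
      using T.rank_nullity_main(2)[OF l quot_im[unfolded T.im_def]]
        T.V.fin_dim_subspace[OF l T.kerT_is_subspace, unfolded quot_ker quot_update_carrier]
      by (rule conjI)
  next
    assume ?r
    then show ?l
      by (intro T.fin_dim_if_fin_dim_ker_im) (unfold quot_im quot_ker quot_update_carrier, simp_all)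
  qed
qed

text \<open>Rank-nullity for the canonical map, read off with its image and kernel as
  quotients.\<close>

lemma quot_dim_add:
  assumes "vectorspace.fin_dim residue_field (quot_module M N P)"
  shows "vectorspace.dim residue_field (quot_module M N P) =
    vectorspace.dim residue_field (quot_module M (submodule_sum N K) K) +
    vectorspace.dim residue_field (quot_module M (N \<inter> K) P)"
proof -
  interpret T: linear_map residue_field "quot_module M N P"
    "quot_module M (submodule_sum N K) K" "\<lambda>X. K <+>\<^bsub>M\<^esub> X" by (rule quot_linear_map)
  show ?thesis
    using T.rank_nullity[OF assms, unfolded quot_im quot_ker quot_update_carrier] by (rule sym)
qed

end

end

section \<open>Dimensions of sums and intersections\<close>

context residue_module
begin

text \<open>The only coset is \<open>P\<close> itself, so the empty set generates. This disposes of
  the trivial kernel at the bottom of the filtration.\<close>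

lemma quot_self_dim:
  assumes "submodule R P M"
  shows "vectorspace.fin_dim residue_field (quot_module M P P)"
    and "vectorspace.dim residue_field (quot_module M P P) = 0"
proof -
  have "subquotient P P"
    using assms submodule.smult_closed[OF assms] max.Icarr by (auto simp: subquotient_def)
  then interpret Q: vectorspace residue_field "quot_module M P P"
    by (rule subquotient_vectorspace)
  interpret P: abelian_subgroup P M using assms by (rule submodule_abelian_subgroup)
  have "carrier (quot_module M P P) = (\<lambda>_. P) ` P"
    unfolding quot_carrier Setcompr_eq_image using P.a_rcos_const by (intro image_cong refl)
  then have "carrier (quot_module M P P) = {\<zero>\<^bsub>quot_module M P P\<^esub>}"
    using submodule.zero_closed[OF assms] by (auto simp: quot_zero)
  then have "Q.gen_set {}"
    by (simp add: Q.span_empty)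
  then show "Q.fin_dim" "Q.dim = 0"
    using Q.gen_ge_dim[of "{}"] by (auto simp: Q.fin_dim_def)
qed

text \<open>Filter \<open>(U + W)/(U' + W')\<close> by \<open>U + W'\<close> and \<open>(U \<inter> W)/(U' \<inter> W')\<close> by \<open>U \<inter> W'\<close>, and compare
  the factors with those of \<open>U/U'\<close> and \<open>W/W'\<close> by the second isomorphism theorem.\<close>

lemma quot_dim_sum_inter:
  fixes U U' W W'
  assumes U: "subquotient U U'" and W: "subquotient W W'"
    and fU: "vectorspace.fin_dim residue_field (quot_module M U U')"
    and fW: "vectorspace.fin_dim residue_field (quot_module M W W')"
  shows "vectorspace.dim residue_field (quot_module M (submodule_sum U W) (submodule_sum U' W')) +
    vectorspace.dim residue_field (quot_module M (U \<inter> W) (U' \<inter> W')) =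
    vectorspace.dim residue_field (quot_module M U U') +
    vectorspace.dim residue_field (quot_module M W W')"
proof -
  have s: "submodule R U M" "submodule R W M" "submodule R U' M" "submodule R W' M"
    and sub: "U' \<subseteq> U" "W' \<subseteq> W"
    using U W by (auto simp: subquotient_def)
  let ?UW' = "submodule_sum U W'" and ?U'W' = "submodule_sum U' W'" and ?UW = "submodule_sum U W"
  have sums: "submodule R ?UW' M" "submodule R ?U'W' M" "submodule R ?UW M"
    using s by (auto intro: sum_is_submodule)
  have incl: "U \<subseteq> ?UW'" "W' \<subseteq> ?UW'" "U' \<subseteq> ?U'W'" "W' \<subseteq> ?U'W'" "U \<subseteq> ?UW" "W \<subseteq> ?UW"
    using s by (simp_all add: in_sum in_sum2)
  have incl': "?U'W' \<subseteq> ?UW'" "?UW' \<subseteq> ?UW"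
    using sum_is_minimal[OF s(3,4) sums(1)] sum_is_minimal[OF s(1,4) sums(3)] sub incl by blast+
  have sum_eqI: "submodule_sum N K = L"
    if "submodule R N M" "submodule R K M" "submodule R L M" "N \<subseteq> L" "K \<subseteq> L"
      "L \<subseteq> submodule_sum N K" for N K L
    using that sum_is_minimal[OF that(1-3)] by blast
  \<comment> \<open>The canonical maps produce images and kernels as raw sums and intersections:
    \<open>e1\<close>, \<open>e3\<close>, \<open>e5\<close> simplify the images, \<open>e2\<close>,
    \<open>e4\<close>, \<open>e6\<close> the kernels.\<close>
  have e1: "submodule_sum W ?UW' = ?UW"
  proof (rule sum_eqI)
    show "?UW \<subseteq> submodule_sum W ?UW'"
      using sum_is_minimal[OF s(1,2) sum_is_submodule[OF s(2) sums(1)]] incl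
        in_sum[OF s(2) sums(1)] in_sum2[OF s(2) sums(1)] by blast
  qed (fact s sums incl incl')+
  have e3: "submodule_sum U ?U'W' = ?UW'"
  proof (rule sum_eqI)
    show "?UW' \<subseteq> submodule_sum U ?U'W'"
      using sum_is_minimal[OF s(1,4) sum_is_submodule[OF s(1) sums(2)]] incl
        in_sum[OF s(1) sums(2)] in_sum2[OF s(1) sums(2)] by blast
  qed (fact s sums incl incl')+
  have e5: "submodule_sum ?UW ?UW' = ?UW"
    using sums incl' in_sum[OF sums(3,1)] by (intro sum_eqI) simp_all
  have e2: "W \<inter> ?UW' = submodule_sum (U \<inter> W) W'"
    using submodule_modular_law[OF s(1,2,4) sub(2)] .
  have e4: "U \<inter> ?U'W' = submodule_sum (U \<inter> W') U'"
    using submodule_modular_law[OF s(4,1,3) sub(1)] msum_comm[OF s(3,4)] by (simp add: Int_commute)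
  have e6: "?UW \<inter> ?UW' = ?UW'" "U \<inter> W \<inter> W' = U \<inter> W'" "U \<inter> W' \<inter> U' = U' \<inter> W'"
    using incl' sub by auto
  have sq1: "subquotient (U \<inter> W) (U' \<inter> W')"
    using U W submodule_inter by (auto simp: subquotient_def)
  have sq2: "subquotient (U \<inter> W') (U' \<inter> W')"
    using U W submodule_inter submodule.smult_closed[OF s(4)] max.Icarr
    by (auto simp: subquotient_def)
  have sq3: "subquotient ?UW ?U'W'"
  proof -
    have "a \<odot>\<^bsub>M\<^esub> x \<in> ?U'W'" if "a \<in> \<mm>" "x \<in> ?UW" for a x
    proof -
      from that obtain u w where x: "u \<in> U" "w \<in> W" "x = u \<oplus>\<^bsub>M\<^esub> w"
        by (auto simp: mem_submodule_sum)
      then have "a \<odot>\<^bsub>M\<^esub> x = a \<odot>\<^bsub>M\<^esub> u \<oplus>\<^bsub>M\<^esub> a \<odot>\<^bsub>M\<^esub> w"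
        using that s max.Icarr by (auto simp: submodule_def intro!: smult_r_distr)
      moreover have "a \<odot>\<^bsub>M\<^esub> u \<in> U'" "a \<odot>\<^bsub>M\<^esub> w \<in> W'"
        using U W x that by (auto simp: subquotient_def)
      ultimately show ?thesis unfolding mem_submodule_sum by blast
    qed
    then show ?thesis using sums incl' by (auto simp: subquotient_def)
  qed
  \<comment> \<open>Each fact pairs a subquotient with the submodule to reduce it by.
    \<open>qW\<close> splits \<open>W/W'\<close> into \<open>(U + W)/(U + W')\<close> and
    \<open>((U \<inter> W) + W')/W'\<close>; \<open>qU\<close> splits \<open>U/U'\<close> into
    \<open>(U + W')/(U' + W')\<close> and \<open>((U \<inter> W') + U')/U'\<close>. Then
    \<open>qUW\<close> recombines the two images, and \<open>qI\<close> with \<open>qI'\<close> the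
    two kernels.\<close>
  note qW = W sums(1) incl(2) and qU = U sums(2) incl(3) and qUW = sq3 sums(1) incl'(1)
    and qI = sq1 s(4) Int_lower2 and qI' = sq2 s(3) Int_lower1
  note fW' = fW[unfolded quot_fin_dim_iff[OF qW] e1 e2]
    and fU' = fU[unfolded quot_fin_dim_iff[OF qU] e3 e4]
  \<comment> \<open>Finite dimension is given for \<open>U/U'\<close> and \<open>W/W'\<close> only;
    their factors pass it to the sum and, by way of \<open>fI'\<close>, to the intersection.\<close>
  have fUW: "vectorspace.fin_dim residue_field (quot_module M ?UW ?U'W')"
    unfolding quot_fin_dim_iff[OF qUW] e5 e6 using fU' fW' by simp
  have fI': "vectorspace.fin_dim residue_field (quot_module M (U \<inter> W') (U' \<inter> W'))"
    unfolding quot_fin_dim_iff[OF qI'] e6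
    using fU' quot_self_dim(1) submodule_inter[OF s(3,4)] by simp
  have fI: "vectorspace.fin_dim residue_field (quot_module M (U \<inter> W) (U' \<inter> W'))"
    unfolding quot_fin_dim_iff[OF qI] e6 using fW' fI' by simp
  show ?thesis
    \<comment> \<open>Both sides count the same four factors once; the last fact removes the zero
      summand left by \<open>qI'\<close>.\<close>
    using quot_dim_add[OF qW fW] quot_dim_add[OF qU fU] quot_dim_add[OF qUW fUW]
      quot_dim_add[OF qI fI] quot_dim_add[OF qI' fI']
      quot_self_dim(2)[OF submodule_inter[OF s(3,4)]]
    unfolding e1 e2 e3 e4 e5 e6 by simp
qed

end

section \<open>Spans of families and multiples by ideals\<close>

definition fam_span where
  "fam_span M A J I = (\<lambda>\<alpha>. \<Oplus>\<^bsub>M\<^esub>i\<in>I. \<alpha> i \<odot>\<^bsub>M\<^esub> A i) ` (I \<rightarrow> J)"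

context module
begin

text \<open>Coefficients from an ideal are closed under addition and under scaling by
  \<open>R\<close>. The two cases of interest are \<open>carrier R\<close>, giving the generated
  submodule, and \<mm>, giving its \<mm>-multiple.\<close>

lemma fam_span_submodule:
  assumes J: "ideal J R" and A: "A \<in> I \<rightarrow> carrier M"
  shows "submodule R (fam_span M A J I) M"
proof -
  interpret J: ideal J R by fact
  have Jc: "\<alpha> i \<in> carrier R" if "\<alpha> \<in> I \<rightarrow> J" "i \<in> I" for \<alpha> i
    using that J.Icarr by (auto simp: Pi_iff)
  have cl: "(\<lambda>i. \<alpha> i \<odot>\<^bsub>M\<^esub> A i) \<in> I \<rightarrow> carrier M" if "\<alpha> \<in> I \<rightarrow> J" for \<alpha>
    using that Jc A by (auto simp: Pi_iff)
  show ?thesis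
  proof
    show "fam_span M A J I \<subseteq> carrier M"
      using cl by (auto simp: fam_span_def intro!: M.finsum_closed)
  next
    fix v w assume "v \<in> fam_span M A J I" "w \<in> fam_span M A J I"
    then obtain \<alpha> \<beta> where \<alpha>: "\<alpha> \<in> I \<rightarrow> J" "v = (\<Oplus>\<^bsub>M\<^esub>i\<in>I. \<alpha> i \<odot>\<^bsub>M\<^esub> A i)"
      and \<beta>: "\<beta> \<in> I \<rightarrow> J" "w = (\<Oplus>\<^bsub>M\<^esub>i\<in>I. \<beta> i \<odot>\<^bsub>M\<^esub> A i)"
      by (auto simp: fam_span_def)
    have "v \<oplus>\<^bsub>M\<^esub> w = (\<Oplus>\<^bsub>M\<^esub>i\<in>I. \<alpha> i \<odot>\<^bsub>M\<^esub> A i \<oplus>\<^bsub>M\<^esub> \<beta> i \<odot>\<^bsub>M\<^esub> A i)"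
      using \<alpha> \<beta> cl by (simp add: M.finsum_addf)
    also have "\<dots> = (\<Oplus>\<^bsub>M\<^esub>i\<in>I. (\<alpha> i \<oplus> \<beta> i) \<odot>\<^bsub>M\<^esub> A i)"
      using \<alpha> \<beta> A Jc by (intro M.finsum_cong') (auto simp: smult_l_distr Pi_iff)
    finally show "v \<oplus>\<^bsub>M\<^esub> w \<in> fam_span M A J I"
      using \<alpha> \<beta> by (auto simp: fam_span_def Pi_iff intro!: image_eqI[where x = "\<lambda>i. \<alpha> i \<oplus> \<beta> i"])
  next
    have "(\<Oplus>\<^bsub>M\<^esub>i\<in>I. \<zero> \<odot>\<^bsub>M\<^esub> A i) = \<zero>\<^bsub>M\<^esub>"
      using A by (subst M.finsum_cong'[where g = "\<lambda>_. \<zero>\<^bsub>M\<^esub>"]) (auto simp: Pi_iff)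
    then show "\<zero>\<^bsub>M\<^esub> \<in> fam_span M A J I"
      unfolding fam_span_def by (intro image_eqI[where x = "\<lambda>_. \<zero>"]) auto
  next
    fix c v assume c: "c \<in> carrier R" and "v \<in> fam_span M A J I"
    then obtain \<alpha> where \<alpha>: "\<alpha> \<in> I \<rightarrow> J" "v = (\<Oplus>\<^bsub>M\<^esub>i\<in>I. \<alpha> i \<odot>\<^bsub>M\<^esub> A i)"
      by (auto simp: fam_span_def)
    have "c \<odot>\<^bsub>M\<^esub> v = (\<Oplus>\<^bsub>M\<^esub>i\<in>I. c \<odot>\<^bsub>M\<^esub> (\<alpha> i \<odot>\<^bsub>M\<^esub> A i))"
      using \<alpha> c cl by (simp add: finsum_smult)
    also have "\<dots> = (\<Oplus>\<^bsub>M\<^esub>i\<in>I. (c \<otimes> \<alpha> i) \<odot>\<^bsub>M\<^esub> A i)"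
      using \<alpha> c A Jc by (intro M.finsum_cong') (auto simp: smult_assoc1 Pi_iff)
    finally show "c \<odot>\<^bsub>M\<^esub> v \<in> fam_span M A J I"
      using \<alpha> c J.I_l_closed
      by (auto simp: fam_span_def Pi_iff intro!: image_eqI[where x = "\<lambda>i. c \<otimes> \<alpha> i"])
  qed
qed

lemma smult_mem_fam_span:
  assumes J: "ideal J R" and A: "A \<in> I \<rightarrow> carrier M" and "finite I" "i \<in> I" "a \<in> J"
  shows "a \<odot>\<^bsub>M\<^esub> A i \<in> fam_span M A J I"
proof -
  interpret J: ideal J R by fact
  have a: "a \<in> carrier R" using assms J.Icarr by auto
  have "(\<Oplus>\<^bsub>M\<^esub>j\<in>I. (if i = j then a else \<zero>) \<odot>\<^bsub>M\<^esub> A j) =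
      (\<Oplus>\<^bsub>M\<^esub>j\<in>I. if i = j then a \<odot>\<^bsub>M\<^esub> A j else \<zero>\<^bsub>M\<^esub>)"
    using A a by (intro M.finsum_cong') (auto simp: Pi_iff)
  also have "\<dots> = a \<odot>\<^bsub>M\<^esub> A i"
    using assms a by (intro M.finsum_singleton) (auto simp: Pi_iff)
  finally show ?thesis
    using \<open>a \<in> J\<close> unfolding fam_span_def
    by (intro image_eqI[where x = "\<lambda>j. if i = j then a else \<zero>"]) auto
qed

lemma gen_submodule_submodule:
  assumes "A \<in> I \<rightarrow> carrier M"
  shows "submodule R (gen_submodule R M A I) M"
  unfolding gen_submodule_def using assms by (intro span_is_submodule) auto

lemma gen_submodule_subset_iff:
  assumes A: "A \<in> I \<rightarrow> carrier M" and N: "submodule R N M"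
  shows "gen_submodule R M A I \<subseteq> N \<longleftrightarrow> A ` I \<subseteq> N"
proof -
  have "A ` I \<subseteq> carrier M" using A by auto
  then show ?thesis
    unfolding gen_submodule_def
    using span_is_subset[OF _ N, of "A ` I"] in_own_span[of "A ` I"] by (metis subset_trans)
qed

lemma gen_submodule_eq_fam_span:
  assumes A: "A \<in> I \<rightarrow> carrier M" and "finite I"
  shows "gen_submodule R M A I = fam_span M A (carrier R) I"
proof
  have "A i \<in> fam_span M A (carrier R) I" if "i \<in> I" for i
    using smult_mem_fam_span[OF R.oneideal A \<open>finite I\<close> that R.one_closed] A that by (simp add: Pi_iff)
  then show "gen_submodule R M A I \<subseteq> fam_span M A (carrier R) I"
    using fam_span_submodule[OF R.oneideal A] by (subst gen_submodule_subset_iff[OF A]) auto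
  note g = gen_submodule_submodule[OF A]
  have "A i \<in> gen_submodule R M A I" if "i \<in> I" for i
    using that gen_submodule_subset_iff[OF A g] by auto
  then show "fam_span M A (carrier R) I \<subseteq> gen_submodule R M A I"
    by (auto simp: fam_span_def Pi_iff intro!: submodule_finsum_closed[OF g] submodule.smult_closed[OF g])
qed

lemma ideal_smult_submodule:
  assumes "ideal J R" and "N \<subseteq> carrier M"
  shows "submodule R (ideal_smult R M J N) M"
  unfolding ideal_smult_def
  using assms ideal.Icarr[OF assms(1)] by (intro span_is_submodule) auto

text \<open>Universal property of the span: inclusions out of an ideal multiple are tested on single
  products, not on their sums.\<close>

lemma ideal_smult_subset_iff:
  assumes J: "ideal J R" and N: "N \<subseteq> carrier M" and P: "submodule R P M"
  shows "ideal_smult R M J N \<subseteq> P \<longleftrightarrow> (\<forall>a\<in>J. \<forall>x\<in>N. a \<odot>\<^bsub>M\<^esub> x \<in> P)"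
proof -
  have "{a \<odot>\<^bsub>M\<^esub> v |a v. a \<in> J \<and> v \<in> N} \<subseteq> carrier M"
    using N ideal.Icarr[OF J] by auto
  note c = in_own_span[OF this]
  show ?thesis
    unfolding ideal_smult_def
    using span_is_subset[OF _ P, of "{a \<odot>\<^bsub>M\<^esub> v |a v. a \<in> J \<and> v \<in> N}"] c by blast
qed

lemma ideal_smultI:
  assumes J: "ideal J R" and N: "N \<subseteq> carrier M" and "a \<in> J" "x \<in> N"
  shows "a \<odot>\<^bsub>M\<^esub> x \<in> ideal_smult R M J N"
  using ideal_smult_subset_iff[OF J N ideal_smult_submodule[OF J N]] assms by auto

lemma ideal_smult_mono:
  assumes J: "ideal J R" and N: "N \<subseteq> N'" "N' \<subseteq> carrier M"
  shows "ideal_smult R M J N \<subseteq> ideal_smult R M J N'"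
proof -
  have "N \<subseteq> carrier M" using N by auto
  then show ?thesis
    using ideal_smultI[OF J N(2)] N(1)
    by (subst ideal_smult_subset_iff[OF J _ ideal_smult_submodule[OF J N(2)]]) auto
qed

text \<open>Distributivity brings the quotient for \<open>X \<union> Y\<close> into the form
  \<open>(U + W)/(U' + W')\<close> required by the dimension formula.\<close>

lemma ideal_smult_sum:
  assumes J: "ideal J R" and U: "submodule R U M" and W: "submodule R W M"
  shows "ideal_smult R M J (submodule_sum U W) =
    submodule_sum (ideal_smult R M J U) (ideal_smult R M J W)"
proof
  have c: "U \<subseteq> carrier M" "W \<subseteq> carrier M" "submodule_sum U W \<subseteq> carrier M"
    using U W sum_is_submodule[OF U W] by (auto simp: submodule_def)
  note s = ideal_smult_submodule[OF J c(1)] ideal_smult_submodule[OF J c(2)]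
    ideal_smult_submodule[OF J c(3)]
  show "submodule_sum (ideal_smult R M J U) (ideal_smult R M J W)
      \<subseteq> ideal_smult R M J (submodule_sum U W)"
    using sum_is_minimal[OF s] ideal_smult_mono[OF J in_sum[OF U W] c(3)]
      ideal_smult_mono[OF J in_sum2[OF U W] c(3)] by blast
  have "a \<odot>\<^bsub>M\<^esub> x \<in> submodule_sum (ideal_smult R M J U) (ideal_smult R M J W)"
    if a: "a \<in> J" and "x \<in> submodule_sum U W" for a x
  proof -
    from that obtain u w where x: "u \<in> U" "w \<in> W" "x = u \<oplus>\<^bsub>M\<^esub> w"
      by (auto simp: mem_submodule_sum)
    then have "a \<odot>\<^bsub>M\<^esub> x = a \<odot>\<^bsub>M\<^esub> u \<oplus>\<^bsub>M\<^esub> a \<odot>\<^bsub>M\<^esub> w"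
      using a c ideal.Icarr[OF J] by (auto intro!: smult_r_distr)
    moreover have "a \<odot>\<^bsub>M\<^esub> u \<in> ideal_smult R M J U" "a \<odot>\<^bsub>M\<^esub> w \<in> ideal_smult R M J W"
      using x a J c by (auto intro!: ideal_smultI)
    ultimately show ?thesis unfolding mem_submodule_sum by blast
  qed
  then show "ideal_smult R M J (submodule_sum U W)
      \<subseteq> submodule_sum (ideal_smult R M J U) (ideal_smult R M J W)"
    using ideal_smult_subset_iff[OF J c(3) sum_is_submodule[OF s(1,2)]] by simp
qed

text \<open>A factor from \<open>J\<close> is absorbed into the coefficients, so one combination
  with coefficients in \<open>J\<close> suffices. This explicit form is what coefficient comparison
  needs.\<close>

lemma ideal_smult_gen_submodule:
  assumes J: "ideal J R" and A: "A \<in> I \<rightarrow> carrier M" and "finite I"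
  shows "ideal_smult R M J (gen_submodule R M A I) = fam_span M A J I"
proof
  note g = gen_submodule_submodule[OF A]
  then have gc: "gen_submodule R M A I \<subseteq> carrier M" by (rule submodule.subset)
  have Ag: "A i \<in> gen_submodule R M A I" if "i \<in> I" for i
    using that gen_submodule_subset_iff[OF A g] by auto
  show "fam_span M A J I \<subseteq> ideal_smult R M J (gen_submodule R M A I)"
    using Ag by (auto simp: fam_span_def Pi_iff
        intro!: submodule_finsum_closed ideal_smult_submodule[OF J gc] ideal_smultI[OF J gc])
  have "a \<odot>\<^bsub>M\<^esub> x \<in> fam_span M A J I" if a: "a \<in> J" and "x \<in> gen_submodule R M A I" for a x
  proof -
    from that obtain \<alpha> where \<alpha>: "\<alpha> \<in> I \<rightarrow> carrier R" "x = (\<Oplus>\<^bsub>M\<^esub>i\<in>I. \<alpha> i \<odot>\<^bsub>M\<^esub> A i)"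
      unfolding gen_submodule_eq_fam_span[OF A \<open>finite I\<close>] by (auto simp: fam_span_def)
    have ac: "a \<in> carrier R" using ideal.Icarr[OF J a] .
    have "a \<odot>\<^bsub>M\<^esub> x = (\<Oplus>\<^bsub>M\<^esub>i\<in>I. a \<odot>\<^bsub>M\<^esub> (\<alpha> i \<odot>\<^bsub>M\<^esub> A i))"
      unfolding \<alpha>(2) using \<alpha>(1) ac A by (intro finsum_smult) (auto simp: Pi_iff)
    also have "\<dots> = (\<Oplus>\<^bsub>M\<^esub>i\<in>I. (a \<otimes> \<alpha> i) \<odot>\<^bsub>M\<^esub> A i)"
      using \<alpha> ac A by (intro M.finsum_cong') (auto simp: smult_assoc1 Pi_iff)
    finally show ?thesis
      using \<alpha>(1) a ideal.I_r_closed[OF J]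
      by (auto simp: fam_span_def Pi_iff intro!: image_eqI[where x = "\<lambda>i. a \<otimes> \<alpha> i"])
  qed
  then show "ideal_smult R M J (gen_submodule R M A I) \<subseteq> fam_span M A J I"
    using ideal_smult_subset_iff[OF J gc fam_span_submodule[OF J A]] by auto
qed

lemma gen_submodule_Un:
  assumes "A \<in> X \<union> Y \<rightarrow> carrier M"
  shows "gen_submodule R M A (X \<union> Y) =
    submodule_sum (gen_submodule R M A X) (gen_submodule R M A Y)"
  unfolding gen_submodule_def image_Un using assms by (intro span_union_is_sum) auto

end

section \<open>Bases of subquotients coming from families\<close>

context residue_module
begin

lemma subquotient_ideal_smult:
  assumes "submodule R N M"
  shows "subquotient N (ideal_smult R M \<mm> N)"
proof -
  note N = submodule.subset[OF assms]
  have "ideal_smult R M \<mm> N \<subseteq> N"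
    using ideal_smult_subset_iff[OF max.ideal_axioms N assms] max.Icarr
      submodule.smult_closed[OF assms] by auto
  then show ?thesis
    using assms ideal_smult_submodule[OF max.ideal_axioms N] ideal_smultI[OF max.ideal_axioms N]
    by (simp add: subquotient_def)
qed

text \<open>This turns a relation between cosets into membership of a combination of representatives
  in \<open>P\<close>.\<close>

lemma finsum_quot:
  assumes NP: "subquotient N P" and A: "A \<in> B \<rightarrow> N" and \<alpha>: "\<alpha> \<in> B \<rightarrow> carrier R" and "finite B"
  shows "(\<Oplus>\<^bsub>quot_module M N P\<^esub>i\<in>B. (\<mm> +> \<alpha> i) \<odot>\<^bsub>quot_module M N P\<^esub> (P +>\<^bsub>M\<^esub> A i)) =
    P +>\<^bsub>M\<^esub> (\<Oplus>\<^bsub>M\<^esub>i\<in>B. \<alpha> i \<odot>\<^bsub>M\<^esub> A i)"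
proof -
  let ?Q = "quot_module M N P"
  interpret Q: vectorspace residue_field ?Q by (rule subquotient_vectorspace[OF NP])
  have N: "submodule R N M" and P: "submodule R P M" using NP by (auto simp: subquotient_def)
  interpret P': abelian_subgroup P M using P by (rule submodule_abelian_subgroup)
  show ?thesis
    using \<open>finite B\<close> A \<alpha>
  proof (induction B)
    case empty
    then show ?case
      using P'.a_rcos_const[of "\<zero>\<^bsub>M\<^esub>"] submodule.zero_closed[OF P] by (simp add: quot_zero)
  next
    case (insert i B)
    have AN: "A j \<in> N" and \<alpha>c: "\<alpha> j \<in> carrier R" if "j \<in> insert i B" for j
      using insert.prems that by (auto simp: Pi_iff)
    have sN: "\<alpha> j \<odot>\<^bsub>M\<^esub> A j \<in> N" if "j \<in> insert i B" for j
      using submodule.smult_closed[OF N] AN[OF that] \<alpha>c[OF that] by blast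
    have sc: "\<alpha> j \<odot>\<^bsub>M\<^esub> A j \<in> carrier M" if "j \<in> insert i B" for j
      using sN[OF that] submodule.subset[OF N] by auto
    have q: "(\<mm> +> \<alpha> j) \<odot>\<^bsub>?Q\<^esub> (P +>\<^bsub>M\<^esub> A j) = P +>\<^bsub>M\<^esub> (\<alpha> j \<odot>\<^bsub>M\<^esub> A j)"
      if "j \<in> insert i B" for j
      using quot_smult[OF NP \<alpha>c[OF that] AN[OF that]] .
    have qc: "(\<mm> +> \<alpha> j) \<odot>\<^bsub>?Q\<^esub> (P +>\<^bsub>M\<^esub> A j) \<in> carrier ?Q" if "j \<in> insert i B" for j
      unfolding q[OF that] quot_carrier using sN[OF that] by blast
    have sum: "(\<Oplus>\<^bsub>M\<^esub>i\<in>B. \<alpha> i \<odot>\<^bsub>M\<^esub> A i) \<in> N"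
      using sN by (intro submodule_finsum_closed[OF N]) auto
    have IH: "(\<Oplus>\<^bsub>?Q\<^esub>i\<in>B. (\<mm> +> \<alpha> i) \<odot>\<^bsub>?Q\<^esub> (P +>\<^bsub>M\<^esub> A i)) =
        P +>\<^bsub>M\<^esub> (\<Oplus>\<^bsub>M\<^esub>i\<in>B. \<alpha> i \<odot>\<^bsub>M\<^esub> A i)"
      using insert.prems by (intro insert.IH) auto
    have "(\<Oplus>\<^bsub>?Q\<^esub>j\<in>insert i B. (\<mm> +> \<alpha> j) \<odot>\<^bsub>?Q\<^esub> (P +>\<^bsub>M\<^esub> A j)) =
        (P +>\<^bsub>M\<^esub> (\<alpha> i \<odot>\<^bsub>M\<^esub> A i)) \<oplus>\<^bsub>?Q\<^esub> (P +>\<^bsub>M\<^esub> (\<Oplus>\<^bsub>M\<^esub>i\<in>B. \<alpha> i \<odot>\<^bsub>M\<^esub> A i))"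
      using insert.hyps qc by (subst Q.finsum_insert) (auto simp: IH q)
    also have "\<dots> = P +>\<^bsub>M\<^esub> (\<alpha> i \<odot>\<^bsub>M\<^esub> A i \<oplus>\<^bsub>M\<^esub> (\<Oplus>\<^bsub>M\<^esub>i\<in>B. \<alpha> i \<odot>\<^bsub>M\<^esub> A i))"
      using sN sum by (intro quot_add[OF NP]) auto
    also have "\<alpha> i \<odot>\<^bsub>M\<^esub> A i \<oplus>\<^bsub>M\<^esub> (\<Oplus>\<^bsub>M\<^esub>i\<in>B. \<alpha> i \<odot>\<^bsub>M\<^esub> A i) =
        (\<Oplus>\<^bsub>M\<^esub>i\<in>insert i B. \<alpha> i \<odot>\<^bsub>M\<^esub> A i)"
      using insert.hyps sc by (subst M.finsum_insert) auto
    finally show ?case .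
  qed
qed

text \<open>The cosets of the \<open>A i\<close> form a basis: they generate because the family
  generates \<open>N\<close>, and a relation among them is a combination lying in \<open>P\<close>,
  whose coefficients \<open>indep\<close> puts into \<mm>, that is, makes zero in the residue
  field.\<close>

lemma quot_dim_eq_card:
  assumes NP: "subquotient N P" and "finite B" and A: "A \<in> B \<rightarrow> N"
    and gen: "N = fam_span M A (carrier R) B"
    and indep: "\<And>\<alpha> i. \<alpha> \<in> B \<rightarrow> carrier R \<Longrightarrow> (\<Oplus>\<^bsub>M\<^esub>i\<in>B. \<alpha> i \<odot>\<^bsub>M\<^esub> A i) \<in> P \<Longrightarrow> i \<in> B \<Longrightarrow> \<alpha> i \<in> \<mm>"
  shows "vectorspace.fin_dim residue_field (quot_module M N P)"
    and "vectorspace.dim residue_field (quot_module M N P) = card B"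
proof -
  let ?Q = "quot_module M N P"
  let ?\<pi> = "\<lambda>i. P +>\<^bsub>M\<^esub> A i"
  interpret Q: vectorspace residue_field ?Q by (rule subquotient_vectorspace[OF NP])
  have P: "submodule R P M" and Nc: "N \<subseteq> carrier M"
    using NP subquotient_carrier by (auto simp: subquotient_def)
  interpret P': abelian_subgroup P M using P by (rule submodule_abelian_subgroup)
  have AN: "A i \<in> N" and Ac: "A i \<in> carrier M" if "i \<in> B" for i
    using that A Nc by (auto simp: Pi_iff)
  have \<pi>c: "?\<pi> ` B \<subseteq> carrier ?Q" using AN by (auto simp: quot_carrier)
  have zero_iff: "P +>\<^bsub>M\<^esub> x = \<zero>\<^bsub>?Q\<^esub> \<longleftrightarrow> x \<in> P" if "x \<in> carrier M" for x
    unfolding quot_zero using P'.a_rcos_const[of x] P'.a_rcos_self[OF that] by metis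
  \<comment> \<open>A basis is a set of cosets, so it has \<open>card B\<close> members only if no
    two indices share one. If \<open>i\<close> and \<open>j\<close> did, the coefficients
    \<open>\<one>\<close> and \<open>\<ominus> \<one>\<close> would give an element of
    \<open>P\<close> and force \<open>\<one> \<in> \<mm>\<close>.\<close>
  have inj: "inj_on ?\<pi> B"
  proof (rule inj_onI, rule ccontr)
    fix i j assume ij: "i \<in> B" "j \<in> B" "?\<pi> i = ?\<pi> j" "i \<noteq> j"
    let ?\<alpha> = "\<lambda>k. if k = i then \<one> else if k = j then \<ominus> \<one> else \<zero>"
    have B: "B = insert i (insert j (B - {i, j}))" using ij by auto
    have "(\<Oplus>\<^bsub>M\<^esub>k\<in>B - {i, j}. ?\<alpha> k \<odot>\<^bsub>M\<^esub> A k) = (\<Oplus>\<^bsub>M\<^esub>k\<in>B - {i, j}. \<zero>\<^bsub>M\<^esub>)"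
      using Ac by (intro M.finsum_cong') auto
    then have rest: "(\<Oplus>\<^bsub>M\<^esub>k\<in>B - {i, j}. ?\<alpha> k \<odot>\<^bsub>M\<^esub> A k) = \<zero>\<^bsub>M\<^esub>" by simp
    have "(\<Oplus>\<^bsub>M\<^esub>k\<in>B. ?\<alpha> k \<odot>\<^bsub>M\<^esub> A k) =
        ?\<alpha> i \<odot>\<^bsub>M\<^esub> A i \<oplus>\<^bsub>M\<^esub> (?\<alpha> j \<odot>\<^bsub>M\<^esub> A j \<oplus>\<^bsub>M\<^esub> (\<Oplus>\<^bsub>M\<^esub>k\<in>B - {i, j}. ?\<alpha> k \<odot>\<^bsub>M\<^esub> A k))"
      using \<open>finite B\<close> ij Ac by (subst B, subst M.finsum_insert, simp, simp, force, force,
          subst M.finsum_insert) auto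
    also have "\<dots> = A i \<ominus>\<^bsub>M\<^esub> A j"
      unfolding rest using ij Ac by (simp add: a_minus_def smult_minus_1)
    also have "\<dots> \<in> P" using ij Ac coset_eq_iff[OF P] by simp
    finally have "?\<alpha> i \<in> \<mm>" using ij by (intro indep) auto
    then show False using max.one_imp_carrier max.I_notcarr by simp
  qed
  have "x \<in> Q.span (?\<pi> ` B)" if "x \<in> carrier ?Q" for x
  proof -
    from that obtain \<alpha> where \<alpha>: "\<alpha> \<in> B \<rightarrow> carrier R" "x = P +>\<^bsub>M\<^esub> (\<Oplus>\<^bsub>M\<^esub>i\<in>B. \<alpha> i \<odot>\<^bsub>M\<^esub> A i)"
      unfolding quot_carrier gen fam_span_def by auto
    have "\<mm> +> \<alpha> i \<in> carrier residue_field" if "i \<in> B" for i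
      using that \<alpha> by (auto simp: residue_field_carrier Pi_iff)
    then show ?thesis
      unfolding \<alpha>(2) finsum_quot[OF NP A \<alpha>(1) \<open>finite B\<close>, symmetric]
      using Q.in_own_span[OF \<pi>c]
      by (intro Q.submodule_finsum_closed Q.span_is_submodule[OF \<pi>c])
        (auto intro!: submodule.smult_closed[OF Q.span_is_submodule[OF \<pi>c]])
  qed
  then have genQ: "Q.gen_set (?\<pi> ` B)"
    using Q.span_is_subset2[OF \<pi>c] by auto
  have "Q.lin_indpt (?\<pi> ` B)"
  proof (rule Q.finite_lin_indpt2[OF _ \<pi>c])
    fix a assume a: "a \<in> ?\<pi> ` B \<rightarrow> carrier residue_field" and 0: "Q.lincomb a (?\<pi> ` B) = \<zero>\<^bsub>?Q\<^esub>"
    \<comment> \<open>Lift the residue coefficients to \<open>R\<close>, where \<open>indep\<close>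
      applies.\<close>
    have "\<forall>i\<in>B. \<exists>r\<in>carrier R. a (?\<pi> i) = \<mm> +> r"
      using a by (auto simp: residue_field_carrier Pi_iff)
    then obtain \<alpha> where \<alpha>: "\<And>i. i \<in> B \<Longrightarrow> \<alpha> i \<in> carrier R" "\<And>i. i \<in> B \<Longrightarrow> a (?\<pi> i) = \<mm> +> \<alpha> i"
      by metis
    have F: "\<mm> +> \<alpha> i \<in> carrier residue_field" if "i \<in> B" for i
      unfolding residue_field_carrier using \<alpha>(1)[OF that] by blast
    have "Q.lincomb a (?\<pi> ` B) = (\<Oplus>\<^bsub>?Q\<^esub>i\<in>B. a (?\<pi> i) \<odot>\<^bsub>?Q\<^esub> ?\<pi> i)"
      unfolding Q.lincomb_def using a \<pi>c inj by (intro Q.finsum_reindex) auto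
    also have "\<dots> = (\<Oplus>\<^bsub>?Q\<^esub>i\<in>B. (\<mm> +> \<alpha> i) \<odot>\<^bsub>?Q\<^esub> ?\<pi> i)"
    proof (intro Q.finsum_cong')
      show "(\<lambda>i. (\<mm> +> \<alpha> i) \<odot>\<^bsub>?Q\<^esub> ?\<pi> i) \<in> B \<rightarrow> carrier ?Q"
        using \<pi>c F by (auto intro!: Q.smult_closed)
    qed (simp_all add: \<alpha>)
    also have "\<dots> = P +>\<^bsub>M\<^esub> (\<Oplus>\<^bsub>M\<^esub>i\<in>B. \<alpha> i \<odot>\<^bsub>M\<^esub> A i)"
      using \<alpha>(1) \<open>finite B\<close> A by (intro finsum_quot[OF NP]) auto
    finally have "(\<Oplus>\<^bsub>M\<^esub>i\<in>B. \<alpha> i \<odot>\<^bsub>M\<^esub> A i) \<in> P"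
      using 0 \<alpha>(1) Ac zero_iff[of "\<Oplus>\<^bsub>M\<^esub>i\<in>B. \<alpha> i \<odot>\<^bsub>M\<^esub> A i"] by (simp add: M.finsum_closed)
    then have "\<alpha> i \<in> \<mm>" if "i \<in> B" for i
      using that \<alpha>(1) by (intro indep) auto
    then show "\<forall>v\<in>?\<pi> ` B. a v = \<zero>\<^bsub>residue_field\<^esub>"
      using \<alpha>(2) max.a_rcos_const by (auto simp: FactRing_def)
  qed (use \<open>finite B\<close> in auto)
  then have "Q.basis (?\<pi> ` B)" using genQ \<pi>c by (simp add: Q.basis_def)
  then show "Q.fin_dim" "Q.dim = card B"
    using Q.dim_basis[of "?\<pi> ` B"] \<open>finite B\<close> genQ \<pi>c card_image[OF inj]
    by (auto simp: Q.fin_dim_def)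
qed

end

section \<open>Divisibility and units in chain rings\<close>

context chain_ring
begin

text \<open>Of two principal ideals, one contains the other.\<close>

lemma divides_or_divides:
  assumes "a \<in> carrier R" "b \<in> carrier R"
  shows "(\<exists>c\<in>carrier R. a = c \<otimes> b) \<or> (\<exists>c\<in>carrier R. b = c \<otimes> a)"
  using ideals_chain[OF cgenideal_ideal[OF assms(1)] cgenideal_ideal[OF assms(2)]]
    cgenideal_self[OF assms(1)] cgenideal_self[OF assms(2)]
  by (auto simp: cgenideal_def)

text \<open>Divisibility is a total preorder here, so comparing the new member with the current
  common divisor decides which one to keep; transitivity covers the older members.\<close>

lemma finite_family_divisor:
  assumes "finite I" "I \<noteq> {}" "a \<in> I \<rightarrow> carrier R"
  shows "\<exists>j\<in>I. \<forall>i\<in>I. \<exists>c\<in>carrier R. a i = c \<otimes> a j"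
  using assms
proof (induction I rule: finite_ne_induct)
  case (singleton x)
  then show ?case by (auto intro!: bexI[of _ \<one>])
next
  case (insert x I)
  have ac: "a i \<in> carrier R" if "i \<in> insert x I" for i using insert.prems that by auto
  obtain j where j: "j \<in> I" "\<forall>i\<in>I. \<exists>c\<in>carrier R. a i = c \<otimes> a j"
    using insert by auto
  consider c where "c \<in> carrier R" "a x = c \<otimes> a j" | c where "c \<in> carrier R" "a j = c \<otimes> a x"
    using divides_or_divides[of "a x" "a j"] ac j(1) by auto
  then show ?case
  proof cases
    case 1
    then show ?thesis using j by auto
  next
    case 2
    have "\<exists>d\<in>carrier R. a i = d \<otimes> a x" if i: "i \<in> I" for i
    proof -
      obtain d where "d \<in> carrier R" "a i = d \<otimes> a j" using j i by auto
      then show ?thesis using 2 ac by (intro bexI[of _ "d \<otimes> c"]) (auto simp: m_assoc)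
    qed
    moreover have "\<exists>d\<in>carrier R. a x = d \<otimes> a x" using ac by (intro bexI[of _ \<one>]) auto
    ultimately show ?thesis by auto
  qed
qed

text \<open>The principal ideal of \<open>x\<close> is not inside \<mm>, so by comparability it
  contains \<mm>, properly, and maximality makes it the whole ring.\<close>

lemma not_in_maximalideal_Units:
  assumes "maximalideal \<mm> R" "x \<in> carrier R" "x \<notin> \<mm>"
  shows "x \<in> Units R"
proof -
  interpret max: maximalideal \<mm> R by fact
  have x: "ideal (PIdl x) R" "x \<in> PIdl x"
    using assms(2) by (auto intro: cgenideal_ideal cgenideal_self)
  then have "\<mm> \<subseteq> PIdl x" using ideals_chain[OF x(1) max.ideal_axioms] assms(3) by auto
  then have "PIdl x = carrier R"
    using max.I_maximal[OF x(1)] x(2) assms(3) ideal.Icarr[OF x(1)] by auto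
  then have "\<one> \<in> PIdl x" by simp
  then obtain y where y: "y \<in> carrier R" "y \<otimes> x = \<one>"
    by (auto simp: cgenideal_def)
  moreover have "x \<otimes> y = \<one>" using y assms(2) m_comm by simp
  ultimately show ?thesis
    using assms(2) unfolding Units_def by blast
qed

end

section \<open>Modular independence and rank over a chain ring\<close>

locale chain_residue_module = residue_module + chain: chain_ring R
begin

text \<open>Elimination: among the coefficients of one generator in the family one divides all others,
  so subtracting multiples of its row removes both this row and the generator.\<close>

lemma modular_independent_card_le:
  assumes "finite J" "g \<in> J \<rightarrow> carrier M" "finite I" "A \<in> I \<rightarrow> fam_span M g (carrier R) J"
    and "modular_independent R \<mm> M A I"
  shows "card I \<le> card J"
  using assms
\<comment> \<open>Elimination shrinks the index set and alters the vectors, so \<open>I\<close> and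
  \<open>A\<close> must both vary.\<close>
proof (induction J arbitrary: I A)
  case empty
  \<comment> \<open>Without generators all vectors vanish, so taking every coefficient to be
    \<open>\<one>\<close> gives a relation; independence then leaves no index.\<close>
  have "A i = \<zero>\<^bsub>M\<^esub>" if "i \<in> I" for i
    using empty.prems(3) that by (auto simp: fam_span_def Pi_iff)
  then have "(\<Oplus>\<^bsub>M\<^esub>i\<in>I. \<one> \<odot>\<^bsub>M\<^esub> A i) = (\<Oplus>\<^bsub>M\<^esub>i\<in>I. \<zero>\<^bsub>M\<^esub>)"
    by (intro M.finsum_cong') auto
  then have "(\<Oplus>\<^bsub>M\<^esub>i\<in>I. \<one> \<odot>\<^bsub>M\<^esub> A i) = \<zero>\<^bsub>M\<^esub>" by simp
  then have "\<forall>i\<in>I. \<one> \<in> \<mm>"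
    using empty.prems(4)[unfolded modular_independent_def, rule_format, of "\<lambda>_. \<one>"] by auto
  then have "I = {}" using max.one_imp_carrier max.I_notcarr by blast
  then show ?case by simp
next
  case (insert j J)
  show ?case
  proof (cases "I = {}")
    case False
    have gJ: "g \<in> J \<rightarrow> carrier M" and gj: "g j \<in> carrier M" using insert.prems(1) by auto
    let ?H = "fam_span M g (carrier R) J"
    have H: "submodule R ?H M" by (rule fam_span_submodule[OF R.oneideal gJ])
    interpret H: submodule R ?H M by (rule H)
    have "\<exists>a\<in>carrier R. \<exists>h\<in>?H. A i = a \<odot>\<^bsub>M\<^esub> g j \<oplus>\<^bsub>M\<^esub> h" if i: "i \<in> I" for i
    proof -
      have "A i \<in> fam_span M g (carrier R) (insert j J)" using insert.prems(3) i by auto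
      then obtain \<beta> where \<beta>: "\<beta> \<in> insert j J \<rightarrow> carrier R"
        "A i = (\<Oplus>\<^bsub>M\<^esub>k\<in>insert j J. \<beta> k \<odot>\<^bsub>M\<^esub> g k)"
        by (auto simp: fam_span_def)
      have "A i = \<beta> j \<odot>\<^bsub>M\<^esub> g j \<oplus>\<^bsub>M\<^esub> (\<Oplus>\<^bsub>M\<^esub>k\<in>J. \<beta> k \<odot>\<^bsub>M\<^esub> g k)"
        unfolding \<beta>(2) using \<beta>(1) insert.hyps gj gJ
        by (intro M.finsum_insert) (auto simp: Pi_iff)
      moreover have "(\<Oplus>\<^bsub>M\<^esub>k\<in>J. \<beta> k \<odot>\<^bsub>M\<^esub> g k) \<in> ?H" "\<beta> j \<in> carrier R"
        using \<beta>(1) by (auto simp: fam_span_def)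
      ultimately show ?thesis by blast
    qed
    then obtain a h where ah: "\<And>i. i \<in> I \<Longrightarrow> a i \<in> carrier R" "\<And>i. i \<in> I \<Longrightarrow> h i \<in> ?H"
      "\<And>i. i \<in> I \<Longrightarrow> A i = a i \<odot>\<^bsub>M\<^esub> g j \<oplus>\<^bsub>M\<^esub> h i"
      by metis
    have hc: "h i \<in> carrier M" if "i \<in> I" for i using ah(2)[OF that] H.subset by auto
    have Ac: "A i \<in> carrier M" if "i \<in> I" for i
      using ah(1,3)[OF that] hc[OF that] gj by simp
    obtain i0 where i0: "i0 \<in> I" "\<forall>i\<in>I. \<exists>c\<in>carrier R. a i = c \<otimes> a i0"
      using chain.finite_family_divisor[OF insert.prems(2) False, of a] ah(1) by auto
    then obtain c where c: "\<And>i. i \<in> I \<Longrightarrow> c i \<in> carrier R" "\<And>i. i \<in> I \<Longrightarrow> a i = c i \<otimes> a i0"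
      by metis
    let ?I = "I - {i0}"
    let ?A = "\<lambda>i. A i \<ominus>\<^bsub>M\<^esub> c i \<odot>\<^bsub>M\<^esub> A i0"
    \<comment> \<open>The \<open>g j\<close> parts cancel because
      \<open>a i = c i \<otimes> a i0\<close>, so the reduced vector lies in the span over
      \<open>J\<close>.\<close>
    have "?A i = h i \<ominus>\<^bsub>M\<^esub> c i \<odot>\<^bsub>M\<^esub> h i0" if i: "i \<in> I" for i
    proof -
      define y where "y = a i \<odot>\<^bsub>M\<^esub> g j"
      have y: "y \<in> carrier M" "c i \<odot>\<^bsub>M\<^esub> (a i0 \<odot>\<^bsub>M\<^esub> g j) = y"
        using ah(1)[OF i] ah(1)[OF i0(1)] c(1)[OF i] gj
        by (simp_all add: y_def c(2)[OF i] smult_assoc1)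
      have "c i \<odot>\<^bsub>M\<^esub> A i0 = y \<oplus>\<^bsub>M\<^esub> c i \<odot>\<^bsub>M\<^esub> h i0"
        using ah(1)[OF i0(1)] c(1)[OF i] gj hc[OF i0(1)]
        by (simp add: ah(3)[OF i0(1)] smult_r_distr y(2))
      moreover have "A i = y \<oplus>\<^bsub>M\<^esub> h i" by (simp add: ah(3)[OF i] y_def)
      ultimately show ?thesis
        using y(1) hc[OF i] hc[OF i0(1)] c(1)[OF i]
        by (simp add: a_minus_def M.minus_add M.a_comm[of y "h i"] M.a_assoc M.r_neg2)
    qed
    then have "?A i \<in> ?H" if "i \<in> ?I" for i
      using that submodule_a_minus_closed[OF H ah(2)[of i] H.smult_closed[OF c(1)[of i] ah(2)[OF i0(1)]]]
      by simp
    moreover have "modular_independent R \<mm> M ?A ?I"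
      unfolding modular_independent_def
    proof (intro ballI impI)
      fix \<alpha> i assume \<alpha>: "\<alpha> \<in> ?I \<rightarrow> carrier R" and 0: "(\<Oplus>\<^bsub>M\<^esub>i\<in>?I. \<alpha> i \<odot>\<^bsub>M\<^esub> ?A i) = \<zero>\<^bsub>M\<^esub>"
        and i: "i \<in> ?I"
      have \<alpha>c: "\<alpha> k \<in> carrier R" if "k \<in> ?I" for k using \<alpha> that by auto
      \<comment> \<open>Expanding each \<open>?A k\<close> turns the relation into one for
        \<open>A\<close>: \<open>b\<close> is the coefficient collected by \<open>A i0\<close>, and
        all other coefficients stay the same.\<close>
      define b where "b = (\<Oplus>k\<in>?I. \<ominus> (\<alpha> k \<otimes> c k))"
      have b: "b \<in> carrier R" unfolding b_def using \<alpha>c c(1) by (intro R.finsum_closed) auto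
      let ?\<gamma> = "\<lambda>k. if k = i0 then b else \<alpha> k"
      have "(\<Oplus>\<^bsub>M\<^esub>k\<in>I. ?\<gamma> k \<odot>\<^bsub>M\<^esub> A k) = (\<Oplus>\<^bsub>M\<^esub>k\<in>insert i0 ?I. ?\<gamma> k \<odot>\<^bsub>M\<^esub> A k)"
        using i0(1) by (simp add: insert_absorb)
      also have "\<dots> = b \<odot>\<^bsub>M\<^esub> A i0 \<oplus>\<^bsub>M\<^esub> (\<Oplus>\<^bsub>M\<^esub>k\<in>?I. ?\<gamma> k \<odot>\<^bsub>M\<^esub> A k)"
        using insert.prems(2) i0(1) b \<alpha>c Ac by (subst M.finsum_insert) auto
      also have "(\<Oplus>\<^bsub>M\<^esub>k\<in>?I. ?\<gamma> k \<odot>\<^bsub>M\<^esub> A k) = (\<Oplus>\<^bsub>M\<^esub>k\<in>?I. \<alpha> k \<odot>\<^bsub>M\<^esub> A k)"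
        using \<alpha>c Ac by (intro M.finsum_cong') auto
      also have "b \<odot>\<^bsub>M\<^esub> A i0 = (\<Oplus>\<^bsub>M\<^esub>k\<in>?I. (\<ominus> (\<alpha> k \<otimes> c k)) \<odot>\<^bsub>M\<^esub> A i0)"
        unfolding b_def using \<alpha>c c(1) Ac i0(1) by (intro finsum_smult_r) auto
      also have "(\<Oplus>\<^bsub>M\<^esub>k\<in>?I. (\<ominus> (\<alpha> k \<otimes> c k)) \<odot>\<^bsub>M\<^esub> A i0) \<oplus>\<^bsub>M\<^esub> (\<Oplus>\<^bsub>M\<^esub>k\<in>?I. \<alpha> k \<odot>\<^bsub>M\<^esub> A k) =
          (\<Oplus>\<^bsub>M\<^esub>k\<in>?I. (\<ominus> (\<alpha> k \<otimes> c k)) \<odot>\<^bsub>M\<^esub> A i0 \<oplus>\<^bsub>M\<^esub> \<alpha> k \<odot>\<^bsub>M\<^esub> A k)"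
        using \<alpha>c c(1) Ac i0(1) by (intro M.finsum_addf[symmetric]) auto
      also have "\<dots> = (\<Oplus>\<^bsub>M\<^esub>k\<in>?I. \<alpha> k \<odot>\<^bsub>M\<^esub> ?A k)"
        using \<alpha>c c(1) Ac i0(1)
        by (intro M.finsum_cong')
          (auto simp: a_minus_def smult_r_distr smult_r_minus smult_l_minus smult_assoc1 M.a_comm)
      also have "\<dots> = \<zero>\<^bsub>M\<^esub>" by (rule 0)
      finally have "?\<gamma> i \<in> \<mm>"
        using insert.prems(4)[unfolded modular_independent_def, rule_format, of ?\<gamma> i] b \<alpha>c i by auto
      then show "\<alpha> i \<in> \<mm>" using i by auto
    qed
    ultimately have "card ?I \<le> card J"
      using insert.prems(2) gJ by (intro insert.IH) auto
    then show ?thesis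
      using insert.hyps insert.prems(2) i0(1) by (simp add: card_Diff_singleton)
  qed simp
qed

text \<open>A coefficient outside \<mm> would survive subtraction of the \<mm>-combination as a
  unit, and \<open>A j\<close> could be solved for in terms of the others. Allowing an
  \<mm>-combination in place of zero lets the result serve both for the basis of the quotient and
  for modular independence.\<close>

lemma minimal_generators_independent:
  assumes A: "A \<in> B \<rightarrow> carrier M" and "finite B"
    and min: "\<And>j. j \<in> B \<Longrightarrow> A j \<notin> gen_submodule R M A (B - {j})"
    and \<alpha>: "\<alpha> \<in> B \<rightarrow> carrier R" and P: "(\<Oplus>\<^bsub>M\<^esub>i\<in>B. \<alpha> i \<odot>\<^bsub>M\<^esub> A i) \<in> fam_span M A \<mm> B"
    and j: "j \<in> B"
  shows "\<alpha> j \<in> \<mm>"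
proof (rule ccontr)
  assume nj: "\<alpha> j \<notin> \<mm>"
  obtain \<mu> where \<mu>: "\<mu> \<in> B \<rightarrow> \<mm>" "(\<Oplus>\<^bsub>M\<^esub>i\<in>B. \<alpha> i \<odot>\<^bsub>M\<^esub> A i) = (\<Oplus>\<^bsub>M\<^esub>i\<in>B. \<mu> i \<odot>\<^bsub>M\<^esub> A i)"
    using P by (auto simp: fam_span_def)
  have c: "A i \<in> carrier M" "\<alpha> i \<in> carrier R" "\<mu> i \<in> carrier R" if "i \<in> B" for i
    using that A \<alpha> \<mu>(1) max.Icarr by (auto simp: Pi_iff)
  define \<beta> where "\<beta> i = \<alpha> i \<ominus> \<mu> i" for i
  have \<beta>: "\<beta> i \<in> carrier R" if "i \<in> B" for i using c[OF that] by (simp add: \<beta>_def)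
  have "(\<Oplus>\<^bsub>M\<^esub>i\<in>B. \<alpha> i \<odot>\<^bsub>M\<^esub> A i) = (\<Oplus>\<^bsub>M\<^esub>i\<in>B. \<beta> i \<odot>\<^bsub>M\<^esub> A i \<oplus>\<^bsub>M\<^esub> \<mu> i \<odot>\<^bsub>M\<^esub> A i)"
  proof (intro M.finsum_cong')
    fix i assume "i \<in> B"
    note i = c[OF this]
    have "\<alpha> i = \<beta> i \<oplus> \<mu> i" using i by (simp add: \<beta>_def a_minus_def R.a_assoc R.l_neg)
    then show "\<alpha> i \<odot>\<^bsub>M\<^esub> A i = \<beta> i \<odot>\<^bsub>M\<^esub> A i \<oplus>\<^bsub>M\<^esub> \<mu> i \<odot>\<^bsub>M\<^esub> A i"
      using i \<beta>[OF \<open>i \<in> B\<close>] by (simp add: smult_l_distr)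
  qed (use c \<beta> in auto)
  also have "\<dots> = (\<Oplus>\<^bsub>M\<^esub>i\<in>B. \<beta> i \<odot>\<^bsub>M\<^esub> A i) \<oplus>\<^bsub>M\<^esub> (\<Oplus>\<^bsub>M\<^esub>i\<in>B. \<mu> i \<odot>\<^bsub>M\<^esub> A i)"
    using c \<beta> by (intro M.finsum_addf) auto
  finally have "(\<Oplus>\<^bsub>M\<^esub>i\<in>B. \<beta> i \<odot>\<^bsub>M\<^esub> A i) \<oplus>\<^bsub>M\<^esub> (\<Oplus>\<^bsub>M\<^esub>i\<in>B. \<mu> i \<odot>\<^bsub>M\<^esub> A i) =
      (\<Oplus>\<^bsub>M\<^esub>i\<in>B. \<mu> i \<odot>\<^bsub>M\<^esub> A i)"
    using \<mu>(2) by simp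
  moreover have fc: "(\<Oplus>\<^bsub>M\<^esub>i\<in>B. \<beta> i \<odot>\<^bsub>M\<^esub> A i) \<in> carrier M" "(\<Oplus>\<^bsub>M\<^esub>i\<in>B. \<mu> i \<odot>\<^bsub>M\<^esub> A i) \<in> carrier M"
    using c \<beta> by (auto intro!: M.finsum_closed)
  ultimately have "(\<Oplus>\<^bsub>M\<^esub>i\<in>B. \<beta> i \<odot>\<^bsub>M\<^esub> A i) = \<zero>\<^bsub>M\<^esub>"
    by (metis M.show_l_zero)
  moreover have "(\<Oplus>\<^bsub>M\<^esub>i\<in>B. \<beta> i \<odot>\<^bsub>M\<^esub> A i) =
      \<beta> j \<odot>\<^bsub>M\<^esub> A j \<oplus>\<^bsub>M\<^esub> (\<Oplus>\<^bsub>M\<^esub>i\<in>B - {j}. \<beta> i \<odot>\<^bsub>M\<^esub> A i)"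
    using c \<beta> j \<open>finite B\<close> M.finsum_insert[of "B - {j}" j "\<lambda>i. \<beta> i \<odot>\<^bsub>M\<^esub> A i"]
    by (simp add: insert_absorb Pi_iff)
  ultimately have rel: "\<beta> j \<odot>\<^bsub>M\<^esub> A j = \<ominus>\<^bsub>M\<^esub> (\<Oplus>\<^bsub>M\<^esub>i\<in>B - {j}. \<beta> i \<odot>\<^bsub>M\<^esub> A i)"
    using c \<beta> j by (intro M.minus_equality[symmetric]) (auto intro!: M.finsum_closed)
  \<comment> \<open>Subtracting \<open>\<mu> j\<close>, which lies in \<mm>, cannot move
    \<open>\<alpha> j\<close> into \<mm>.\<close>
  have "\<beta> j \<notin> \<mm>"
  proof
    assume "\<beta> j \<in> \<mm>"
    then have "\<beta> j \<oplus> \<mu> j \<in> \<mm>" using \<mu>(1) j by (intro max.a_closed) auto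
    moreover have "\<beta> j \<oplus> \<mu> j = \<alpha> j"
      using c j by (simp add: \<beta>_def a_minus_def R.a_assoc R.l_neg)
    ultimately show False using nj by simp
  qed
  then have u: "\<beta> j \<in> Units R"
    using chain.not_in_maximalideal_Units[OF max.maximalideal_axioms] \<beta> j by blast
  have A': "A \<in> B - {j} \<rightarrow> carrier M" using A by auto
  note g = gen_submodule_submodule[OF A']
  have "(\<Oplus>\<^bsub>M\<^esub>i\<in>B - {j}. \<beta> i \<odot>\<^bsub>M\<^esub> A i) \<in> gen_submodule R M A (B - {j})"
    using \<beta> \<open>finite B\<close> A' by (subst gen_submodule_eq_fam_span) (auto simp: fam_span_def)
  \<comment> \<open>Dividing the relation by the unit \<open>\<beta> j\<close> puts
    \<open>A j\<close> into the span of the remaining vectors, against minimality.\<close>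
  then have "inv (\<beta> j) \<odot>\<^bsub>M\<^esub> (\<beta> j \<odot>\<^bsub>M\<^esub> A j) \<in> gen_submodule R M A (B - {j})"
    unfolding rel using u submodule_minus_closed[OF g] submodule.smult_closed[OF g] by auto
  moreover have "inv (\<beta> j) \<odot>\<^bsub>M\<^esub> (\<beta> j \<odot>\<^bsub>M\<^esub> A j) = A j"
    using u c j \<beta> by (simp add: smult_assoc1[symmetric])
  ultimately show False using min[OF j] by simp
qed

text \<open>Both claims rest on one minimal generating subfamily \<open>B\<close>: its cosets are a
  basis of the quotient, and \<open>B\<close> is a largest independent subset of
  \<open>X\<close>.\<close>

lemma
  fixes A and X E :: "'e set"
  assumes "finite E" and A: "A \<in> E \<rightarrow> carrier M" and "X \<subseteq> E"
  defines "N \<equiv> gen_submodule R M A X"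
  shows quot_gen_fin_dim:
      "vectorspace.fin_dim residue_field (quot_module M N (ideal_smult R M \<mm> N))"
    and indep_rank_eq_dim: "indep_rank (modular_indep_system R \<mm> M E A) X =
      vectorspace.dim residue_field (quot_module M N (ideal_smult R M \<mm> N))"
proof -
  have fX: "finite X" using assms(1,3) finite_subset by blast
  have AX: "A \<in> S \<rightarrow> carrier M" if "S \<subseteq> X" for S using A \<open>X \<subseteq> E\<close> that by auto
  have sub: "submodule R (gen_submodule R M A S) M" if "S \<subseteq> X" for S
    by (rule gen_submodule_submodule[OF AX[OF that]])
  have gen: "A i \<in> gen_submodule R M A S" if "S \<subseteq> X" "i \<in> S" for S i
    using gen_submodule_subset_iff[OF AX[OF that(1)] sub[OF that(1)]] that(2) by auto
  obtain B where B: "B \<subseteq> X" "minimal B (\<lambda>S. gen_submodule R M A S = N)"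
    using minimal_exists[OF fX, of "\<lambda>S. gen_submodule R M A S = N"] N_def by auto
  have NB: "gen_submodule R M A B = N" and fB: "finite B" and AB: "A \<in> B \<rightarrow> carrier M"
    using B fX finite_subset AX by (auto simp: minimal_def)
  \<comment> \<open>If \<open>j\<close> were redundant, \<open>B - {j}\<close> would still generate
    \<open>N\<close>, against the inclusion-minimal choice of \<open>B\<close>.\<close>
  have min: "A j \<notin> gen_submodule R M A (B - {j})" if j: "j \<in> B" for j
  proof
    assume Aj: "A j \<in> gen_submodule R M A (B - {j})"
    have B': "B - {j} \<subseteq> X" using B(1) by auto
    have "A ` B \<subseteq> gen_submodule R M A (B - {j})"
      using Aj gen[OF B'] by auto
    then have "N \<subseteq> gen_submodule R M A (B - {j})"
      using gen_submodule_subset_iff[OF AB sub[OF B']] NB by simp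
    moreover have "gen_submodule R M A (B - {j}) \<subseteq> N"
      using gen_submodule_subset_iff[OF AX[OF B'] sub[OF B(1)]] gen[OF B(1)] NB by auto
    ultimately have "B - {j} = B" using B(2) by (auto simp: minimal_def)
    then show False using j by auto
  qed
  let ?P = "ideal_smult R M \<mm> N"
  have NP: "subquotient N ?P" using sub[OF B(1)] by (intro subquotient_ideal_smult) (simp add: NB)
  have P: "?P = fam_span M A \<mm> B"
    using ideal_smult_gen_submodule[OF max.ideal_axioms AB fB] by (simp add: NB)
  have N: "N = fam_span M A (carrier R) B"
    using gen_submodule_eq_fam_span[OF AB fB] by (simp add: NB)
  have AN: "A \<in> B \<rightarrow> N" using gen[OF B(1)] NB by auto
  have ind: "\<alpha> i \<in> \<mm>" if "\<alpha> \<in> B \<rightarrow> carrier R" "(\<Oplus>\<^bsub>M\<^esub>i\<in>B. \<alpha> i \<odot>\<^bsub>M\<^esub> A i) \<in> ?P" "i \<in> B" for \<alpha> i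
    using minimal_generators_independent[OF AB fB min that(1) that(2)[unfolded P] that(3)] .
  have dim: "vectorspace.fin_dim residue_field (quot_module M N ?P)"
    "vectorspace.dim residue_field (quot_module M N ?P) = card B"
    by (rule quot_dim_eq_card[OF NP fB AN N], erule (2) ind)+
  have "modular_independent R \<mm> M A B"
    unfolding modular_independent_def
  proof (intro ballI impI)
    fix \<alpha> i assume \<alpha>: "\<alpha> \<in> B \<rightarrow> carrier R" "(\<Oplus>\<^bsub>M\<^esub>i\<in>B. \<alpha> i \<odot>\<^bsub>M\<^esub> A i) = \<zero>\<^bsub>M\<^esub>" "i \<in> B"
    \<comment> \<open>Zero is an element of \<open>?P\<close>, so modular independence is a special
      case of \<open>ind\<close>.\<close>
    have "\<zero>\<^bsub>M\<^esub> \<in> ?P" using NP submodule.zero_closed by (auto simp: subquotient_def)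
    then show "\<alpha> i \<in> \<mm>" using \<alpha> by (intro ind) auto
  qed
  then have "card B \<in> {card I | I. I \<subseteq> X \<and> I \<in> modular_indep_system R \<mm> M E A}"
    using B(1) \<open>X \<subseteq> E\<close> by (auto simp: modular_indep_system_def)
  \<comment> \<open>Every vector indexed by \<open>X\<close> lies in \<open>N\<close>, the span of
    \<open>B\<close>, so the elimination bound applies to any independent \<open>I\<close>.\<close>
  moreover have "card I \<le> card B" if I: "I \<subseteq> X" "I \<in> modular_indep_system R \<mm> M E A" for I
  proof (rule modular_independent_card_le[OF fB AB])
    show "finite I" using I(1) fX finite_subset by blast
    show "A \<in> I \<rightarrow> fam_span M A (carrier R) B"
      using I(1) gen[OF order_refl] by (auto simp: N[symmetric] N_def)
    show "modular_independent R \<mm> M A I" using I(2) by (simp add: modular_indep_system_def)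
  qed
  moreover have "finite {card I | I. I \<subseteq> X \<and> I \<in> modular_indep_system R \<mm> M E A}"
    using fX by simp
  ultimately have "indep_rank (modular_indep_system R \<mm> M E A) X = card B"
    unfolding indep_rank_def by (intro Max_eqI) auto
  then show "vectorspace.fin_dim residue_field (quot_module M N ?P)"
    "indep_rank (modular_indep_system R \<mm> M E A) X =
      vectorspace.dim residue_field (quot_module M N ?P)"
    using dim by simp_all
qed

end

section \<open>Submodularity as a comparison of dimensions\<close>

theorem theorem3p10:
  fixes R :: "('a, 'b) ring_scheme" and \<mm> :: "'a set"
    and V :: "('a, 'v, 'w) module_scheme" and E :: "'e set" and A :: "'e \<Rightarrow> 'v"
  assumes "chain_ring R"
    and "maximalideal \<mm> R"
    and "(\<Inter>l\<in>{1::nat..}. \<mm> [^]\<^bsub>ideals_set R\<^esub> l) = {\<zero>\<^bsub>R\<^esub>}"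
    and "module R V"
    and "finite E"
    and "A \<in> E \<rightarrow> carrier V"
  shows "submodular_on E (indep_rank (modular_indep_system R \<mm> V E A)) \<longleftrightarrow>
    (\<forall>X Y. X \<subseteq> E \<longrightarrow> Y \<subseteq> E \<longrightarrow>
      vectorspace.dim (R Quot \<mm>)
        (quot_module V (gen_submodule R V A (X \<inter> Y))
          (ideal_smult R V \<mm> (gen_submodule R V A (X \<inter> Y)))) \<le>
      vectorspace.dim (R Quot \<mm>)
        (quot_module V (gen_submodule R V A X \<inter> gen_submodule R V A Y)
          (ideal_smult R V \<mm> (gen_submodule R V A X) \<inter> ideal_smult R V \<mm> (gen_submodule R V A Y))))"
proof -
  interpret chain_residue_module R V \<mm>
    using assms by (intro chain_residue_module.intro residue_module.intro)
  let ?r = "indep_rank (modular_indep_system R \<mm> V E A)"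
  let ?N = "gen_submodule R V A" and ?m = "ideal_smult R V \<mm>"
  let ?dim = "\<lambda>N P. vectorspace.dim (R Quot \<mm>) (quot_module V N P)"
  \<comment> \<open>The equivalence already holds for each pair \<open>X\<close>, \<open>Y\<close>
    separately.\<close>
  have "?r (X \<union> Y) + ?r (X \<inter> Y) \<le> ?r X + ?r Y \<longleftrightarrow>
      ?dim (?N (X \<inter> Y)) (?m (?N (X \<inter> Y))) \<le> ?dim (?N X \<inter> ?N Y) (?m (?N X) \<inter> ?m (?N Y))"
    if XY: "X \<subseteq> E" "Y \<subseteq> E" for X Y
  proof -
    have A: "A \<in> X \<rightarrow> carrier V" "A \<in> Y \<rightarrow> carrier V" "A \<in> X \<union> Y \<rightarrow> carrier V"
      using assms(6) XY by auto
    have sub: "submodule R (?N X) V" "submodule R (?N Y) V"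
      using A by (auto intro: gen_submodule_submodule)
    have r: "?r S = ?dim (?N S) (?m (?N S))" if "S \<subseteq> E" for S
      using assms(5,6) that by (rule indep_rank_eq_dim)
    \<comment> \<open>Rewritten as a sum over a sum, the quotient for \<open>X \<union> Y\<close>
      matches the dimension formula with \<open>U = ?N X\<close> and
      \<open>W = ?N Y\<close>.\<close>
    have "?r (X \<union> Y) = ?dim (submodule_sum (?N X) (?N Y)) (submodule_sum (?m (?N X)) (?m (?N Y)))"
      using XY gen_submodule_Un[OF A(3)] ideal_smult_sum[OF max.ideal_axioms sub] r[of "X \<union> Y"]
      by simp
    then have "?r (X \<union> Y) + ?dim (?N X \<inter> ?N Y) (?m (?N X) \<inter> ?m (?N Y)) = ?r X + ?r Y"
      using quot_dim_sum_inter[OF subquotient_ideal_smult[OF sub(1)]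
          subquotient_ideal_smult[OF sub(2)] quot_gen_fin_dim[OF assms(5,6) XY(1)]
          quot_gen_fin_dim[OF assms(5,6) XY(2)]] XY
      by (simp add: r)
    moreover have "?r (X \<inter> Y) = ?dim (?N (X \<inter> Y)) (?m (?N (X \<inter> Y)))"
      using XY by (intro r) auto
    \<comment> \<open>Replacing \<open>?r X + ?r Y\<close> by the identity and cancelling
      \<open>?r (X \<union> Y)\<close> leaves exactly the inequality between dimensions.\<close>
    ultimately show ?thesis by linarith
  qed
  then show ?thesis unfolding submodular_on_def by blast
qed

end
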